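(* There exists a minimal $\Pi^0_1$ subshift $X$ whose model-checking problem for context-free languages is $\Sigma^0_1$-complete.
   Context: For a finite alphabet $S$, give $S^{\mathbb{Z}}$ the product topology and the shift $\sigma(x)_i = x_{i+1}$. A subshift is a closed set $X \subset S^{\mathbb{Z}}$ with $\sigma(X)=X$. $X$ is minimal if its only subshifts are $\emptyset$ and $X$. The language $\mathcal{L}(X)\subset S^*$ is the set of finite words occurring as contiguous subwords of points of $X$; $X$ is $\Pi^0_1$ if $S^*\setminus\mathcal{L}(X)$ is recursively enumerable. The model-checking problem of $X$ for context-free languages is to decide, given a context-free language $L \subset S^*$ (described by a grammar or a pushdown automaton), whether $\mathcal{L}(X) \cap L \neq \emptyset$. Completeness is under many-one reductions. *)

theory Defs
  imports "HOL-Analysis.Analysis" "HOL-Library.Nat_Bijection"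
begin

definition shift :: "(int \<Rightarrow> 'a) \<Rightarrow> (int \<Rightarrow> 'a)" where
  "shift x = (\<lambda>i. x (i + 1))"

definition full_shift :: "'a set \<Rightarrow> (int \<Rightarrow> 'a) topology" where
  "full_shift S = product_topology (\<lambda>_. discrete_topology S) UNIV"

text \<open>\<^const>\<open>closedin\<close> forces every point of \<open>X\<close> to take its values in \<open>S\<close>.\<close>

definition subshift :: "'a set \<Rightarrow> (int \<Rightarrow> 'a) set \<Rightarrow> bool" where
  "subshift S X \<longleftrightarrow> finite S \<and> closedin (full_shift S) X \<and> shift ` X = X"

definition minimal_subshift :: "'a set \<Rightarrow> (int \<Rightarrow> 'a) set \<Rightarrow> bool" where
  "minimal_subshift S X \<longleftrightarrow>
     subshift S X \<and> (\<forall>Y. subshift S Y \<and> Y \<subseteq> X \<longrightarrow> Y = {} \<or> Y = X)"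

definition subword_at :: "(int \<Rightarrow> 'a) \<Rightarrow> int \<Rightarrow> nat \<Rightarrow> 'a list" where
  "subword_at x i n = map (\<lambda>j. x (i + int j)) [0..<n]"

definition language :: "(int \<Rightarrow> 'a) set \<Rightarrow> 'a list set" where
  "language X = {subword_at x i n | x i n. x \<in> X}"


text \<open>
  Kleene's partial recursive functions. Arities are not tracked: \<open>recf_eval p xs\<close> is the value of
  \<open>p\<close> on the argument list \<open>xs\<close>, and \<^const>\<open>None\<close> means that it is undefined there. The first
  argument is the recursion variable of \<open>Pr\<close> and the search variable of \<open>Mn\<close>.
\<close>

datatype recf =
    Zero
  | Succ
  | Proj nat
  | Cn recf "recf list"
  | Pr recf recf
  | Mn recf

fun recf_eval :: "recf \<Rightarrow> nat list \<Rightarrow> nat option" where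
  "recf_eval Zero xs = Some 0"
| "recf_eval Succ xs = (case xs of [] \<Rightarrow> None | x # _ \<Rightarrow> Some (Suc x))"
| "recf_eval (Proj i) xs = (if i < length xs then Some (xs ! i) else None)"
| "recf_eval (Cn f gs) xs = Option.bind (those (map (\<lambda>g. recf_eval g xs) gs)) (\<lambda>ys. recf_eval f ys)"
| "recf_eval (Pr f g) xs =
     (case xs of [] \<Rightarrow> None
      | n # ys \<Rightarrow> rec_nat (recf_eval f ys) (\<lambda>m r. Option.bind r (\<lambda>v. recf_eval g (m # v # ys))) n)"
| "recf_eval (Mn f) xs =
     (if \<exists>n. recf_eval f (n # xs) = Some 0 \<and> (\<forall>m<n. recf_eval f (m # xs) \<noteq> None)
      then Some (LEAST n. recf_eval f (n # xs) = Some 0)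
      else None)"

definition computable :: "(nat \<Rightarrow> nat) \<Rightarrow> bool" where
  "computable h \<longleftrightarrow> (\<exists>p. \<forall>n. recf_eval p [n] = Some (h n))"

definition recursively_enumerable :: "nat set \<Rightarrow> bool" where
  "recursively_enumerable A \<longleftrightarrow> (\<exists>p. A = {n. recf_eval p [n] \<noteq> None})"

definition many_one_reducible :: "nat set \<Rightarrow> nat set \<Rightarrow> bool" (infix "\<le>\<^sub>m" 50) where
  "A \<le>\<^sub>m B \<longleftrightarrow> (\<exists>h. computable h \<and> (\<forall>n. n \<in> A \<longleftrightarrow> h n \<in> B))"

definition sigma01_complete :: "nat set \<Rightarrow> bool" where
  "sigma01_complete A \<longleftrightarrow>
     recursively_enumerable A \<and> (\<forall>B. recursively_enumerable B \<longrightarrow> B \<le>\<^sub>m A)"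

text \<open>Sets of words over a finite alphabet of naturals are coded by \<^const>\<open>list_encode\<close>.\<close>

definition pi01_subshift :: "nat set \<Rightarrow> (int \<Rightarrow> nat) set \<Rightarrow> bool" where
  "pi01_subshift S X \<longleftrightarrow>
     subshift S X \<and> recursively_enumerable (list_encode ` (lists S - language X))"


datatype symbol = NT nat | Tm nat

type_synonym production = "nat \<times> symbol list"

datatype cfg = CFG (start: nat) (productions: "production list")

inductive derive1 :: "cfg \<Rightarrow> symbol list \<Rightarrow> symbol list \<Rightarrow> bool" for G where
  "(A, r) \<in> set (productions G) \<Longrightarrow> derive1 G (u @ [NT A] @ v) (u @ r @ v)"

definition cfg_language :: "cfg \<Rightarrow> nat list set" where
  "cfg_language G = {w. (derive1 G)\<^sup>*\<^sup>* [NT (start G)] (map Tm w)}"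

definition cfg_over :: "nat set \<Rightarrow> cfg \<Rightarrow> bool" where
  "cfg_over S G \<longleftrightarrow> (\<forall>(A, r) \<in> set (productions G). \<forall>a. Tm a \<in> set r \<longrightarrow> a \<in> S)"

text \<open>
  Grammars are coded by the explicit bijections of \<^theory>\<open>HOL-Library.Nat_Bijection\<close>; the coding
  has to be effective, so the choice-based \<open>to_nat\<close> of class \<open>countable\<close> would not do.
\<close>

fun symbol_encode :: "symbol \<Rightarrow> nat" where
  "symbol_encode (NT A) = sum_encode (Inl A)"
| "symbol_encode (Tm a) = sum_encode (Inr a)"

fun production_encode :: "production \<Rightarrow> nat" where
  "production_encode (A, r) = prod_encode (A, list_encode (map symbol_encode r))"

fun cfg_encode :: "cfg \<Rightarrow> nat" where
  "cfg_encode (CFG s P) = prod_encode (s, list_encode (map production_encode P))"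

definition cfg_model_checking :: "nat set \<Rightarrow> (int \<Rightarrow> nat) set \<Rightarrow> nat set" where
  "cfg_model_checking S X =
     {cfg_encode G | G. cfg_over S G \<and> language X \<inter> cfg_language G \<noteq> {}}"

end

theory Submission
  imports Defs "HOL-Library.Sublist"
begin

text \<open>
  The alphabet is \<open>{0, 1, 2}\<close>, to be read as an opening bracket, a separator and a closing bracket.
  For a sequence \<open>m\<close> of positive numbers let \<open>w\<^sub>0\<close> be the empty word and let \<open>w\<^sub>k\<^sub>+\<^sub>1\<close> consist of
  \<open>m\<^sub>k + 3\<close> copies of \<open>w\<^sub>k\<close>, with the letters of \<open>0 1\<dots>1 2\<close> (\<open>m\<^sub>k\<close> ones) placed one by one in the
  gaps between consecutive copies. The points of \<open>X\<close> are the bi-infinite sequences all of whose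
  subwords are subwords of some \<open>w\<^sub>k\<close>.

  For \<open>j \<ge> k\<close> the word \<open>w\<^sub>j\<close> is again a string of copies of \<open>w\<^sub>k\<close> separated by single letters. Hence
  every window of length \<open>2 |w\<^sub>k| + 1\<close> contains \<open>w\<^sub>k\<close> (\<open>long_sublist_weave\<close>), so every orbit in \<open>X\<close>
  is dense and \<open>X\<close> is minimal (\<open>minimal_tower_shift\<close>). Conversely a word of length at most
  \<open>|w\<^sub>k| + 1\<close> meets only one gap (\<open>short_sublist_weave\<close>), and since every letter occurs at every
  level, membership of a word \<open>u\<close> in the language of \<open>X\<close> can be read off \<open>w\<^sub>k\<close> with \<open>k = |u| + 1\<close>
  (\<open>sublist_tower_iff\<close>). For computable \<open>m\<close> the language is therefore decidable.

  Each \<open>w\<^sub>k\<close> is a balanced bracket word in which all separators lie inside brackets, so between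
  a bracket of level \<open>k\<close> and its partner there are exactly \<open>m\<^sub>k\<close> separators that are not enclosed in
  inner brackets. A pushdown automaton can skip the inner brackets, whatever their nesting depth,
  and count up to a fixed \<open>n\<close>. Thus the words consisting of an opening bracket, a balanced word with
  exactly \<open>n\<close> outer separators, and the matching closing bracket form a context-free language which
  meets the language of \<open>X\<close> iff \<open>n\<close> is one of the \<open>m\<^sub>k\<close> (\<open>counting_grammar_meets_tower_iff\<close>).
  The level \<open>k\<close> at which \<open>n\<close> shows up is not bounded in terms of \<open>n\<close>, and this is where
  undecidability enters: \<open>m\<close> enumerates the halting computations (\<open>in_range_marks_iff\<close>), so every
  recursively enumerable set reduces to the model-checking problem. Conversely that problem is
  recursively enumerable, because one can search for a word of the language together with a
  derivation of it.

  On the computability side, all functions involved are shown to be computable through a small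
  calculus of effective functions between types with explicit codes, and both halting and derivability
  are reduced to the existence of a finite certificate whose correctness is decidable.
\<close>

section \<open>Arithmetic in Kleene's calculus\<close>

definition add_rf :: recf where
  "add_rf = Pr (Proj 0) (Cn Succ [Proj 1])"

definition pred_rf :: recf where
  "pred_rf = Pr Zero (Proj 0)"

definition monus_rf :: recf where
  "monus_rf = Pr (Proj 0) (Cn pred_rf [Proj 1])"

definition triangle_rf :: recf where
  "triangle_rf = Pr Zero (Cn add_rf [Proj 1, Cn Succ [Proj 0]])"

definition pair_rf :: recf where
  "pair_rf = Cn add_rf [Cn triangle_rf [add_rf], Proj 0]"

text \<open>
  The number \<open>m + n\<close> of the diagonal that carries the pair \<open>(m, n)\<close> is the least \<open>k\<close> whose next
  triangle number exceeds the code of the pair. Both components are read off from it.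
\<close>

definition diagonal_rf :: recf where
  "diagonal_rf = Mn (Cn monus_rf [Cn triangle_rf [Cn Succ [Proj 0]], Cn Succ [Proj 1]])"

definition fst_rf :: recf where
  "fst_rf = Cn monus_rf [Cn triangle_rf [diagonal_rf], Proj 0]"

definition snd_rf :: recf where
  "snd_rf = Cn monus_rf [fst_rf, diagonal_rf]"

lemma recf_eval_add [simp]: "recf_eval add_rf [m, n] = Some (m + n)"
  by (induction m) (simp_all add: add_rf_def)

lemma recf_eval_pred [simp]: "recf_eval pred_rf [n] = Some (n - 1)"
  by (induction n) (simp_all add: pred_rf_def)

lemma recf_eval_monus [simp]: "recf_eval monus_rf [n, m] = Some (m - n)"
  by (induction n) (simp_all add: monus_rf_def)

lemma recf_eval_triangle [simp]: "recf_eval triangle_rf [n] = Some (triangle n)"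
  by (induction n) (simp_all add: triangle_rf_def)

lemma recf_eval_pair [simp]: "recf_eval pair_rf [m, n] = Some (prod_encode (m, n))"
  by (simp add: pair_rf_def prod_encode_def)

lemma triangle_mono: "m \<le> n \<Longrightarrow> triangle m \<le> triangle n"
  by (induction rule: dec_induct) auto

lemma recf_eval_diagonal [simp]:
  "recf_eval diagonal_rf [prod_encode (m, n)] = Some (m + n)"
proof -
  let ?f = "Cn monus_rf [Cn triangle_rf [Cn Succ [Proj 0]], Cn Succ [Proj 1]]"
  let ?c = "prod_encode (m, n)"
  have f: "recf_eval ?f [k, ?c] = Some (Suc ?c - triangle (Suc k))" for k
    by simp
  have zero: "Suc ?c - triangle (Suc k) = 0 \<longleftrightarrow> m + n \<le> k" for k
  proof
    assume "m + n \<le> k"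
    then have "triangle (Suc (m + n)) \<le> triangle (Suc k)"
      by (intro triangle_mono) simp
    then show "Suc ?c - triangle (Suc k) = 0"
      by (simp add: prod_encode_def)
  next
    assume *: "Suc ?c - triangle (Suc k) = 0"
    show "m + n \<le> k"
    proof (rule ccontr)
      assume "\<not> m + n \<le> k"
      then have "triangle (Suc k) \<le> triangle (m + n)"
        by (intro triangle_mono) simp
      with * show False
        by (simp add: prod_encode_def)
    qed
  qed
  have "(LEAST k. recf_eval ?f [k, ?c] = Some 0) = m + n"
    by (rule Least_equality) (simp_all only: f zero option.inject)
  moreover have "\<exists>k. recf_eval ?f [k, ?c] = Some 0 \<and> (\<forall>j<k. recf_eval ?f [j, ?c] \<noteq> None)"
    by (rule exI[of _ "m + n"]) (simp only: f zero option.inject, simp)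
  ultimately show ?thesis
    unfolding diagonal_rf_def by (simp del: recf_eval.simps add: recf_eval.simps(6))
qed

lemma recf_eval_fst [simp]: "recf_eval fst_rf [prod_encode (m, n)] = Some m"
  by (simp add: fst_rf_def) (simp add: prod_encode_def)

lemma recf_eval_snd [simp]: "recf_eval snd_rf [prod_encode (m, n)] = Some n"
  by (simp add: snd_rf_def)

lemma computable_comp: "computable g \<Longrightarrow> computable f \<Longrightarrow> computable (\<lambda>n. g (f n))"
  unfolding computable_def
proof (elim exE)
  fix p q assume "\<forall>n. recf_eval p [n] = Some (g n)" "\<forall>n. recf_eval q [n] = Some (f n)"
  then show "\<exists>r. \<forall>n. recf_eval r [n] = Some (g (f n))"
    by (intro exI[of _ "Cn p [q]"]) simp
qed

lemma computable_id: "computable (\<lambda>n. n)"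
  unfolding computable_def by (rule exI[of _ "Proj 0"]) simp

lemma computable_Suc: "computable Suc"
  unfolding computable_def by (rule exI[of _ Succ]) simp

lemma computable_const: "computable (\<lambda>n. c)"
proof (induction c)
  case 0
  show ?case unfolding computable_def by (rule exI[of _ Zero]) simp
next
  case (Suc c)
  show ?case using computable_comp[OF computable_Suc Suc] .
qed

lemma computable_pair:
  "computable f \<Longrightarrow> computable g \<Longrightarrow> computable (\<lambda>n. prod_encode (f n, g n))"
  unfolding computable_def
proof (elim exE)
  fix p q assume "\<forall>n. recf_eval p [n] = Some (f n)" "\<forall>n. recf_eval q [n] = Some (g n)"
  then show "\<exists>r. \<forall>n. recf_eval r [n] = Some (prod_encode (f n, g n))"
    by (intro exI[of _ "Cn pair_rf [p, q]"]) simp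
qed

lemma computable_fst: "computable (\<lambda>n. fst (prod_decode n))"
  unfolding computable_def
  by (rule exI[of _ fst_rf]) (metis prod.collapse prod_decode_inverse recf_eval_fst)

lemma computable_snd: "computable (\<lambda>n. snd (prod_decode n))"
  unfolding computable_def
  by (rule exI[of _ snd_rf]) (metis prod.collapse prod_decode_inverse recf_eval_snd)

lemma computable_rec:
  assumes "computable a" "computable g"
  shows "computable (\<lambda>z. rec_nat (a (snd (prod_decode z)))
    (\<lambda>m r. g (prod_encode (m, prod_encode (r, snd (prod_decode z))))) (fst (prod_decode z)))"
proof -
  obtain p q where p: "\<And>n. recf_eval p [n] = Some (a n)" and q: "\<And>n. recf_eval q [n] = Some (g n)"
    using assms unfolding computable_def by blast
  let ?step = "Cn q [Cn pair_rf [Proj 0, Cn pair_rf [Proj 1, Proj 2]]]"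
  have step: "recf_eval ?step [m, r, x] = Some (g (prod_encode (m, prod_encode (r, x))))" for m r x
    using q by simp
  have "recf_eval (Pr p ?step) [n, x] =
      Some (rec_nat (a x) (\<lambda>m r. g (prod_encode (m, prod_encode (r, x)))) n)" for n x
    by (induction n) (simp_all add: p step del: recf_eval.simps(4) One_nat_def)
  then have "recf_eval (Cn (Pr p ?step) [fst_rf, snd_rf]) [prod_encode (n, x)] =
      Some (rec_nat (a x) (\<lambda>m r. g (prod_encode (m, prod_encode (r, x)))) n)" for n x
    by (simp del: recf_eval.simps(5))
  then have "recf_eval (Cn (Pr p ?step) [fst_rf, snd_rf]) [z] =
      Some (rec_nat (a (snd (prod_decode z)))
        (\<lambda>m r. g (prod_encode (m, prod_encode (r, snd (prod_decode z))))) (fst (prod_decode z)))" for z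
    by (metis prod.collapse prod_decode_inverse)
  then show ?thesis
    unfolding computable_def by blast
qed

section \<open>Effective functions between coded types\<close>

text \<open>
  A function between coded types is effective if a computable function on numbers simulates it on
  codes. Such functions are closed under the usual functional programming constructs, so that
  computability proofs reduce to applying introduction rules to \<open>\<lambda>\<close>-terms. Injective codes are enough
  for this; surjective ones are wanted where a number is to be decoded as an arbitrary value,
  notably in unbounded search.
\<close>

class coded =
  fixes encode :: "'a \<Rightarrow> nat"
  assumes encode_inject: "encode x = encode y \<Longrightarrow> x = y"

lemma encode_eq_iff [simp]: "encode x = encode y \<longleftrightarrow> x = y"
  using encode_inject by blast

class coded_onto = coded +
  assumes surj_encode: "surj encode"

definition decode :: "nat \<Rightarrow> 'a::coded_onto" where
  "decode = inv encode"

lemma encode_decode [simp]: "encode (decode n) = n"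
  unfolding decode_def by (rule surj_f_inv_f[OF surj_encode])

lemma decode_encode [simp]: "decode (encode x) = x"
  by (rule encode_inject) simp

definition effective :: "('a::coded \<Rightarrow> 'b::coded) \<Rightarrow> bool" where
  "effective f \<longleftrightarrow> (\<exists>h. computable h \<and> (\<forall>x. h (encode x) = encode (f x)))"

named_theorems effective_intro

instantiation nat :: coded_onto
begin
definition encode_nat :: "nat \<Rightarrow> nat" where [simp]: "encode_nat n = n"
instance by standard (simp_all add: surj_def)
end

instantiation bool :: coded
begin
definition encode_bool :: "bool \<Rightarrow> nat" where [simp]: "encode_bool b = of_bool b"
instance by standard (simp add: of_bool_def split: if_splits)
end

instantiation prod :: (coded, coded) coded
begin
definition encode_prod :: "'a \<times> 'b \<Rightarrow> nat" where
  "encode_prod p = prod_encode (encode (fst p), encode (snd p))"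
instance by standard (simp add: encode_prod_def prod_eq_iff)
end

lemma encode_Pair [simp]: "encode (x, y) = prod_encode (encode x, encode y)"
  by (simp add: encode_prod_def)

instance prod :: (coded_onto, coded_onto) coded_onto
proof (standard, rule surjI)
  show "encode (decode (fst (prod_decode n)) :: 'a, decode (snd (prod_decode n)) :: 'b) = n" for n
    by simp
qed

instantiation sum :: (coded, coded) coded
begin
definition encode_sum :: "'a + 'b \<Rightarrow> nat" where
  "encode_sum s = sum_encode (map_sum encode encode s)"
instance
proof
  show "x = y" if "encode x = encode y" for x y :: "'a + 'b"
    using that by (cases x; cases y) (simp_all add: encode_sum_def sum_encode_eq)
qed
end

instantiation option :: (coded) coded
begin
definition encode_option :: "'a option \<Rightarrow> nat" where
  "encode_option s = (case s of None \<Rightarrow> 0 | Some x \<Rightarrow> Suc (encode x))"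
instance by standard (auto simp: encode_option_def split: option.splits)
end

instantiation list :: (coded) coded
begin
definition encode_list :: "'a list \<Rightarrow> nat" where
  "encode_list xs = list_encode (map encode xs)"
instance by standard (auto simp: encode_list_def list_encode_eq dest!: map_injective intro!: injI)
end

instance list :: (coded_onto) coded_onto
proof (standard, rule surjI)
  show "encode (map decode (list_decode n) :: 'a list) = n" for n
    by (simp add: encode_list_def o_def)
qed

lemma effective_id [effective_intro]: "effective (\<lambda>x. x)"
  unfolding effective_def using computable_id by blast

lemma effective_const [effective_intro]: "effective (\<lambda>x. c)"
  unfolding effective_def using computable_const[of "encode c"] by blast

lemma effective_comp:
  assumes "effective g" "effective f"
  shows "effective (\<lambda>x. g (f x))"
proof -
  obtain h k where "computable h" "\<forall>x. h (encode x) = encode (g x)"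
    "computable k" "\<forall>x. k (encode x) = encode (f x)"
    using assms unfolding effective_def by blast
  then show ?thesis
    unfolding effective_def
    by (intro exI[of _ "\<lambda>n. h (k n)"]) (simp add: computable_comp)
qed

lemma effective_nat_iff: "effective f \<longleftrightarrow> computable f" for f :: "nat \<Rightarrow> nat"
proof -
  have "computable h \<and> (\<forall>x. h x = f x) \<longleftrightarrow> h = f \<and> computable f" for h
    unfolding fun_eq_iff[symmetric] by blast
  then show ?thesis
    unfolding effective_def by simp
qed

text \<open>
  Changing the presentation of a value without changing its code costs nothing. This is how
  constructors and destructors of a new type are inherited from those of an old one.
\<close>

lemma effective_transfer:
  assumes "effective g" "\<And>x. encode (f x) = encode (g x)"
  shows "effective f"
  using assms unfolding effective_def by simp

lemma effective_encode [effective_intro]: "effective f \<Longrightarrow> effective (\<lambda>x. encode (f x))"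
  by (erule effective_transfer) simp

lemma effective_decode [effective_intro]: "effective f \<Longrightarrow> effective (\<lambda>x. decode (f x))"
  by (erule effective_transfer) simp

lemma effective_Pair [effective_intro]:
  assumes "effective f" "effective g"
  shows "effective (\<lambda>x. (f x, g x))"
proof -
  obtain h k where "computable h" "\<forall>x. h (encode x) = encode (f x)"
    "computable k" "\<forall>x. k (encode x) = encode (g x)"
    using assms unfolding effective_def by blast
  then show ?thesis
    unfolding effective_def
    by (intro exI[of _ "\<lambda>n. prod_encode (h n, k n)"]) (simp add: computable_pair)
qed

lemma effective_fst [effective_intro]: "effective f \<Longrightarrow> effective (\<lambda>x. fst (f x))"
proof (rule effective_comp[of fst])
  show "effective (fst :: 'b \<times> 'c \<Rightarrow> _)"
    unfolding effective_def
    by (rule exI[of _ "\<lambda>n. fst (prod_decode n)"]) (simp add: computable_fst encode_prod_def)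
qed

lemma effective_snd [effective_intro]: "effective f \<Longrightarrow> effective (\<lambda>x. snd (f x))"
proof (rule effective_comp[of snd])
  show "effective (snd :: 'b \<times> 'c \<Rightarrow> _)"
    unfolding effective_def
    by (rule exI[of _ "\<lambda>n. snd (prod_decode n)"]) (simp add: computable_snd encode_prod_def)
qed

text \<open>
  A case distinction or recursion binds variables, and the premise of its rule speaks of a function
  on a tuple made of the ambient argument and the bound values. These composition rules
  instantiate an effective function of several arguments inside such a tuple.
\<close>

lemma effective_comp2:
  assumes "effective (\<lambda>p. g (fst p) (snd p))" "effective f1" "effective f2"
  shows "effective (\<lambda>x. g (f1 x) (f2 x))"
  using effective_comp[OF assms(1) effective_Pair[OF assms(2,3)]] by simp

lemma effective_comp3:
  assumes "effective (\<lambda>p. g (fst p) (fst (snd p)) (snd (snd p)))"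
    "effective f1" "effective f2" "effective f3"
  shows "effective (\<lambda>x. g (f1 x) (f2 x) (f3 x))"
  using effective_comp[OF assms(1) effective_Pair[OF assms(2) effective_Pair[OF assms(3,4)]]]
  by simp

lemma effective_comp4:
  assumes "effective (\<lambda>p. g (fst p) (fst (snd p)) (fst (snd (snd p))) (snd (snd (snd p))))"
    "effective f1" "effective f2" "effective f3" "effective f4"
  shows "effective (\<lambda>x. g (f1 x) (f2 x) (f3 x) (f4 x))"
  using effective_comp[OF assms(1)
      effective_Pair[OF assms(2) effective_Pair[OF assms(3) effective_Pair[OF assms(4,5)]]]]
  by simp

lemma effective_Suc [effective_intro]: "effective f \<Longrightarrow> effective (\<lambda>x. Suc (f x))"
  using effective_comp[of Suc f] computable_Suc by (simp add: effective_nat_iff)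

lemma effective_case_prod [effective_intro]:
  "effective (\<lambda>x. f x (fst (p x)) (snd (p x))) \<Longrightarrow> effective (\<lambda>x. case_prod (f x) (p x))"
  by (simp add: case_prod_unfold)

text \<open>
  The ambient argument \<open>x\<close> is carried along as the parameter of primitive recursion, and the
  simulating functions act on codes of the intermediate values, so the result type is arbitrary.
\<close>

lemma effective_rec_nat [effective_intro]:
  assumes "effective n" "effective a"
    and "effective (\<lambda>p. g (fst p) (fst (snd p)) (snd (snd p)))"
  shows "effective (\<lambda>x. rec_nat (a x) (\<lambda>m r. g x m r) (n x))"
proof -
  obtain k where k: "computable k" "\<And>x. k (encode x) = n x"
    using assms(1) unfolding effective_def by auto
  obtain b where b: "computable b" "\<And>x. b (encode x) = encode (a x)"
    using assms(2) unfolding effective_def by blast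
  obtain h where h: "computable h" "\<And>x m r. h (encode (x, m, r)) = encode (g x m r)"
    using assms(3) unfolding effective_def by force
  let ?rec = "\<lambda>z. rec_nat (b (snd (prod_decode z)))
    (\<lambda>m r. (\<lambda>q. h (prod_encode (snd (prod_decode (snd (prod_decode q))),
        prod_encode (fst (prod_decode q), fst (prod_decode (snd (prod_decode q)))))))
      (prod_encode (m, prod_encode (r, snd (prod_decode z))))) (fst (prod_decode z))"
  have "computable ?rec"
    by (intro computable_rec b computable_comp[OF h(1)] computable_pair computable_id
        computable_comp[OF computable_fst] computable_comp[OF computable_snd])
  then have "computable (\<lambda>z. ?rec (prod_encode (k z, z)))"
    by (rule computable_comp) (intro computable_pair k computable_id)
  moreover have "?rec (prod_encode (k (encode x), encode x)) = encode (rec_nat (a x) (g x) (n x))" for x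
  proof -
    have "rec_nat (b (encode x)) (\<lambda>m r. h (prod_encode (encode x, prod_encode (m, r)))) i
        = encode (rec_nat (a x) (g x) i)" for i
      using h(2)[of x] by (induction i) (simp_all add: b)
    then show ?thesis by (simp add: k)
  qed
  ultimately show ?thesis
    unfolding effective_def by blast
qed

lemma effective_case_nat [effective_intro]:
  assumes "effective n" "effective a" "effective (\<lambda>p. g (fst p) (snd p))"
  shows "effective (\<lambda>x. case n x of 0 \<Rightarrow> a x | Suc m \<Rightarrow> g x m)"
proof -
  have "effective (\<lambda>x. rec_nat (a x) (\<lambda>m r. g x m) (n x))"
    by (intro effective_intro assms effective_comp2[OF assms(3)])
  then show ?thesis
    by (rule effective_transfer) (simp split: nat.split)
qed

subsection \<open>Booleans and arithmetic\<close>

lemma effective_if [effective_intro]: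
  assumes "effective b" "effective f" "effective g"
  shows "effective (\<lambda>x. if b x then f x else g x)"
proof -
  have "effective (\<lambda>x. case encode (b x) of 0 \<Rightarrow> g x | Suc m \<Rightarrow> f x)"
    by (intro effective_intro assms effective_comp[OF assms(2)])
  then show ?thesis
    by (rule effective_transfer) simp
qed

lemma effective_conj [effective_intro]:
  "effective P \<Longrightarrow> effective Q \<Longrightarrow> effective (\<lambda>x. P x \<and> Q x)"
  by (rule effective_transfer[of "\<lambda>x. if P x then Q x else False"]) (intro effective_intro, simp_all)

lemma effective_disj [effective_intro]:
  "effective P \<Longrightarrow> effective Q \<Longrightarrow> effective (\<lambda>x. P x \<or> Q x)"
  by (rule effective_transfer[of "\<lambda>x. if P x then True else Q x"]) (intro effective_intro, simp_all)

lemma effective_not [effective_intro]: "effective P \<Longrightarrow> effective (\<lambda>x. \<not> P x)"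
  by (rule effective_transfer[of "\<lambda>x. if P x then False else True"]) (intro effective_intro, simp_all)

lemma effective_add [effective_intro]:
  fixes f g :: "'a::coded \<Rightarrow> nat"
  assumes "effective f" "effective g"
  shows "effective (\<lambda>x. f x + g x)"
proof -
  have "rec_nat n (\<lambda>_ r. Suc r) m = m + n" for m n
    by (induction m) auto
  then have *: "f x + g x = rec_nat (g x) (\<lambda>_ r. Suc r) (f x)" for x
    by metis
  show ?thesis
    unfolding * by (intro effective_intro assms)
qed

lemma effective_diff [effective_intro]:
  fixes f g :: "'a::coded \<Rightarrow> nat"
  assumes "effective f" "effective g"
  shows "effective (\<lambda>x. f x - g x)"
proof -
  have "rec_nat (m :: nat) (\<lambda>_ r. case r of 0 \<Rightarrow> 0 | Suc s \<Rightarrow> s) n = m - n" for m n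
    by (induction n) (auto split: nat.split)
  then have *: "f x - g x = rec_nat (f x) (\<lambda>_ r. case r of 0 \<Rightarrow> 0 | Suc s \<Rightarrow> s) (g x)" for x
    by metis
  show ?thesis
    unfolding * by (intro effective_intro assms)
qed

lemma effective_le [effective_intro]:
  fixes f g :: "'a::coded \<Rightarrow> nat"
  assumes "effective f" "effective g"
  shows "effective (\<lambda>x. f x \<le> g x)"
proof -
  have *: "f x \<le> g x \<longleftrightarrow> (case f x - g x of 0 \<Rightarrow> True | Suc _ \<Rightarrow> False)" for x
    by (auto split: nat.split)
  show ?thesis
    unfolding * by (intro effective_intro assms)
qed

lemma effective_eq [effective_intro]:
  assumes "effective f" "effective g"
  shows "effective (\<lambda>x. f x = g x)"
proof -
  have *: "f x = g x \<longleftrightarrow> encode (f x) \<le> encode (g x) \<and> encode (g x) \<le> encode (f x)" for x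
    by (metis encode_inject order_antisym order_refl)
  show ?thesis
    unfolding * by (intro effective_intro assms)
qed

lemma effective_ball_less [effective_intro]:
  fixes P :: "'a::coded \<Rightarrow> nat \<Rightarrow> bool"
  assumes "effective n" "effective (\<lambda>p. P (fst p) (snd p))"
  shows "effective (\<lambda>x. \<forall>m<n x. P x m)"
proof -
  have "(\<forall>m<k. P x m) = rec_nat True (\<lambda>m r. P x m \<and> r) k" for k x
    by (induction k) (auto simp: less_Suc_eq)
  then have *: "(\<forall>m<n x. P x m) = rec_nat True (\<lambda>m r. P x m \<and> r) (n x)" for x
    by metis
  show ?thesis
    unfolding * by (intro effective_intro assms effective_comp2[OF assms(2)])
qed

lemma effective_bex_less [effective_intro]:
  fixes P :: "'a::coded \<Rightarrow> nat \<Rightarrow> bool"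
  assumes "effective n" "effective (\<lambda>p. P (fst p) (snd p))"
  shows "effective (\<lambda>x. \<exists>m<n x. P x m)"
proof -
  have *: "(\<exists>m<n x. P x m) \<longleftrightarrow> \<not> (\<forall>m<n x. \<not> P x m)" for x
    by blast
  show ?thesis
    unfolding * by (intro effective_intro assms)
qed

subsection \<open>Options, sums and lists\<close>

text \<open>
  The code of \<^const>\<open>None\<close> is 0 and that of \<open>Some y\<close> is a successor, so this is a case distinction on
  the code, whose predecessor is handed on undecoded.
\<close>

lemma effective_case_option [effective_intro]:
  assumes "effective s" "effective a" "effective (\<lambda>p. g (fst p) (snd p))"
  shows "effective (\<lambda>x. case s x of None \<Rightarrow> a x | Some y \<Rightarrow> g x y)"
proof -
  obtain b where b: "computable b" "\<And>x. b (encode x) = encode (a x)"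
    using assms(2) unfolding effective_def by blast
  obtain h where h: "computable h" "\<And>x y. h (encode (x, y)) = encode (g x y)"
    using assms(3) unfolding effective_def by force
  have bh: "effective b" "effective h"
    using b h by (simp_all add: effective_nat_iff)
  have "effective (\<lambda>x. case encode (s x) of 0 \<Rightarrow> b (encode x) | Suc m \<Rightarrow> h (encode (encode x, m)))"
    by (intro effective_intro assms effective_comp[OF bh(1)] effective_comp[OF bh(2)])
  then show ?thesis
    by (rule effective_transfer)
      (use b(2) h(2) in \<open>simp add: encode_option_def split: option.split\<close>)
qed

lemma effective_parity:
  "effective (\<lambda>n::nat. (n div 2, odd n))"
proof -
  have "rec_nat (0, False) (\<lambda>_ r. (if snd r then Suc (fst r) else fst r, \<not> snd r)) n = (n div 2, odd n)"
    for n :: nat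
    by (induction n) auto
  then have *: "(\<lambda>n::nat. (n div 2, odd n)) =
      (\<lambda>n. rec_nat (0, False) (\<lambda>_ r. (if snd r then Suc (fst r) else fst r, \<not> snd r)) n)"
    by auto
  show ?thesis
    unfolding * by (intro effective_intro)
qed

lemma effective_case_sum [effective_intro]:
  assumes "effective s" "effective (\<lambda>p. f (fst p) (snd p))" "effective (\<lambda>p. g (fst p) (snd p))"
  shows "effective (\<lambda>x. case s x of Inl y \<Rightarrow> f x y | Inr y \<Rightarrow> g x y)"
proof -
  obtain k where k: "computable k" "\<And>x y. k (encode (x, y)) = encode (f x y)"
    using assms(2) unfolding effective_def by force
  obtain h where h: "computable h" "\<And>x y. h (encode (x, y)) = encode (g x y)"
    using assms(3) unfolding effective_def by force
  have kh: "effective k" "effective h"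
    using k h by (simp_all add: effective_nat_iff)
  have "effective (\<lambda>x. if snd (encode (s x) div 2, odd (encode (s x)))
      then h (encode (encode x, fst (encode (s x) div 2, odd (encode (s x)))))
      else k (encode (encode x, fst (encode (s x) div 2, odd (encode (s x))))))"
    by (intro effective_intro assms effective_comp[OF kh(1)] effective_comp[OF kh(2)]
        effective_comp[OF effective_parity])
  then show ?thesis
    by (rule effective_transfer)
      (use k(2) h(2) in \<open>simp add: encode_sum_def sum_encode_def split: sum.split\<close>)
qed

lemma effective_Cons [effective_intro]:
  "effective f \<Longrightarrow> effective g \<Longrightarrow> effective (\<lambda>x. f x # g x)"
  by (rule effective_transfer[of "\<lambda>x. Suc (encode (f x, g x))"])
    (intro effective_intro, simp_all add: encode_list_def)

lemma effective_case_list [effective_intro]: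
  assumes "effective l" "effective a" "effective (\<lambda>p. g (fst p) (fst (snd p)) (snd (snd p)))"
  shows "effective (\<lambda>x. case l x of [] \<Rightarrow> a x | y # ys \<Rightarrow> g x y ys)"
proof -
  let ?uncons = "\<lambda>x. case l x of [] \<Rightarrow> None | y # ys \<Rightarrow> Some (y, ys)"
  have "effective ?uncons"
    using assms(1)
    by (rule effective_transfer) (simp add: encode_list_def encode_option_def split: list.split)
  then have "effective (\<lambda>x. case ?uncons x of None \<Rightarrow> a x | Some p \<Rightarrow> g x (fst p) (snd p))"
    by (rule effective_case_option) (intro assms)+
  then show ?thesis
    by (rule effective_transfer) (simp split: list.split)
qed

lemma length_le_list_encode: "length xs \<le> list_encode xs"
  by (induction xs) (auto intro: order_trans[OF _ le_prod_encode_2])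

text \<open>
  Traversing a list is a loop that pops one element in each round. The code of a list bounds its
  length, so that many rounds suffice; once the list is empty, further rounds change nothing.
\<close>

lemma effective_foldl [effective_intro]:
  assumes "effective l" "effective a" "effective (\<lambda>p. f (fst p) (fst (snd p)) (snd (snd p)))"
  shows "effective (\<lambda>x. foldl (\<lambda>s y. f x s y) (a x) (l x))"
proof -
  let ?step = "\<lambda>x s. case snd s of [] \<Rightarrow> s | y # ys \<Rightarrow> (f x (fst s) y, ys)"
  have step: "rec_nat (s, ys) (\<lambda>_. ?step x) n = (foldl (f x) s (take n ys), drop n ys)" for x s ys n
  proof (induction n)
    case (Suc n)
    then show ?case
    proof (cases "drop n ys")
      case (Cons z zs)
      then have "n < length ys"
        by (metis drop_all leI list.distinct(1))
      with Cons have "take (Suc n) ys = take n ys @ [z]" "drop (Suc n) ys = zs"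
        by (auto simp: take_Suc_conv_app_nth simp flip: Cons_nth_drop_Suc)
      with Cons Suc show ?thesis by simp
    qed simp
  qed simp
  have *: "foldl (f x) (a x) (l x) = fst (rec_nat (a x, l x) (\<lambda>_. ?step x) (encode (l x)))" for x
    using length_le_list_encode[of "map encode (l x)"]
    unfolding step by (simp add: encode_list_def)
  show ?thesis
    unfolding * by (intro effective_intro assms effective_comp3[OF assms(3)])
qed

lemma effective_rev [effective_intro]:
  assumes "effective l"
  shows "effective (\<lambda>x. rev (l x))"
proof -
  have "foldl (\<lambda>s y. y # s) ys xs = rev xs @ ys" for xs ys :: "'b list"
    by (induction xs arbitrary: ys) auto
  then have *: "rev (l x) = foldl (\<lambda>s y. y # s) [] (l x)" for x
    by simp
  show ?thesis
    unfolding * by (intro effective_intro assms)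
qed

text \<open>
  Structural recursion consumes a list from the right, hence the fold over the reversed list; the
  accumulator also rebuilds the tail to which the recursive result belongs.
\<close>

lemma effective_rec_list [effective_intro]:
  assumes "effective l" "effective a"
    and "effective (\<lambda>p. g (fst p) (fst (snd p)) (fst (snd (snd p))) (snd (snd (snd p))))"
  shows "effective (\<lambda>x. rec_list (a x) (\<lambda>y ys r. g x y ys r) (l x))"
proof -
  have "foldl (\<lambda>s y. (y # fst s, g x y (fst s) (snd s))) ([], b) (rev xs) =
      (xs, rec_list b (\<lambda>y ys r. g x y ys r) xs)" for x b xs
    by (induction xs) auto
  then have *: "rec_list (a x) (\<lambda>y ys r. g x y ys r) (l x) =
      snd (foldl (\<lambda>s y. (y # fst s, g x y (fst s) (snd s))) ([], a x) (rev (l x)))" for x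
    by simp
  show ?thesis
    unfolding * by (intro effective_intro assms effective_comp4[OF assms(3)])
qed

lemma effective_append [effective_intro]:
  assumes "effective f" "effective g"
  shows "effective (\<lambda>x. f x @ g x)"
proof -
  have "xs @ ys = rec_list ys (\<lambda>y _ r. y # r) xs" for xs ys :: "'b list"
    by (induction xs) auto
  then have *: "f x @ g x = rec_list (g x) (\<lambda>y _ r. y # r) (f x)" for x
    by metis
  show ?thesis
    unfolding * by (intro effective_intro assms)
qed

lemma effective_length [effective_intro]:
  assumes "effective l"
  shows "effective (\<lambda>x. length (l x))"
proof -
  have "length xs = rec_list 0 (\<lambda>_ _ r. Suc r) xs" for xs :: "'b list"
    by (induction xs) auto
  then have *: "length (l x) = rec_list 0 (\<lambda>_ _ r. Suc r) (l x)" for x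
    by metis
  show ?thesis
    unfolding * by (intro effective_intro assms)
qed

lemma effective_drop [effective_intro]:
  assumes "effective n" "effective l"
  shows "effective (\<lambda>x. drop (n x) (l x))"
proof -
  have "drop k xs = rec_nat xs (\<lambda>_ r. case r of [] \<Rightarrow> [] | _ # ys \<Rightarrow> ys) k" for k and xs :: "'b list"
  proof (induction k)
    case (Suc k)
    have "drop (Suc k) xs = tl (drop k xs)"
      by (simp add: drop_Suc tl_drop)
    with Suc show ?case by (simp add: tl_def)
  qed simp
  then have *: "drop (n x) (l x) = rec_nat (l x) (\<lambda>_ r. case r of [] \<Rightarrow> [] | _ # ys \<Rightarrow> ys) (n x)" for x
    by metis
  show ?thesis
    unfolding * by (intro effective_intro assms)
qed

lemma effective_take [effective_intro]:
  assumes "effective n" "effective l"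
  shows "effective (\<lambda>x. take (n x) (l x))"
proof -
  have *: "take (n x) (l x) = rev (drop (length (l x) - n x) (rev (l x)))" for x
    by (cases "n x \<le> length (l x)") (simp_all add: rev_drop)
  show ?thesis
    unfolding * by (intro effective_intro assms)
qed

lemma effective_map [effective_intro]:
  assumes "effective l" "effective (\<lambda>p. f (fst p) (snd p))"
  shows "effective (\<lambda>x. map (\<lambda>y. f x y) (l x))"
proof -
  have "map (f x) xs = rec_list [] (\<lambda>y _ r. f x y # r) xs" for x xs
    by (induction xs) auto
  then have *: "map (f x) (l x) = rec_list [] (\<lambda>y _ r. f x y # r) (l x)" for x
    by metis
  show ?thesis
    unfolding * by (intro effective_intro assms effective_comp2[OF assms(2)])
qed

lemma effective_concat [effective_intro]:
  assumes "effective l"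
  shows "effective (\<lambda>x. concat (l x))"
proof -
  have "concat xs = rec_list [] (\<lambda>y _ r. y @ r) xs" for xs :: "'b list list"
    by (induction xs) auto
  then have *: "concat (l x) = rec_list [] (\<lambda>y _ r. y @ r) (l x)" for x
    by metis
  show ?thesis
    unfolding * by (intro effective_intro assms)
qed

lemma effective_replicate [effective_intro]:
  assumes "effective n" "effective f"
  shows "effective (\<lambda>x. replicate (n x) (f x))"
proof -
  have "replicate k y = rec_nat [] (\<lambda>_ r. y # r) k" for k and y :: 'b
    by (induction k) auto
  then have *: "replicate (n x) (f x) = rec_nat [] (\<lambda>_ r. f x # r) (n x)" for x
    by metis
  show ?thesis
    unfolding * by (intro effective_intro assms effective_comp[OF assms(2)])
qed

lemma effective_ball_set [effective_intro]:
  assumes "effective l" "effective (\<lambda>p. P (fst p) (snd p))"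
  shows "effective (\<lambda>x. \<forall>y\<in>set (l x). P x y)"
proof -
  have "(\<forall>y\<in>set ys. P x y) = rec_list True (\<lambda>y _ r. P x y \<and> r) ys" for x ys
    by (induction ys) auto
  then have *: "(\<forall>y\<in>set (l x). P x y) = rec_list True (\<lambda>y _ r. P x y \<and> r) (l x)" for x
    by metis
  show ?thesis
    unfolding * by (intro effective_intro assms effective_comp2[OF assms(2)])
qed

lemma effective_bex_set [effective_intro]:
  assumes "effective l" "effective (\<lambda>p. P (fst p) (snd p))"
  shows "effective (\<lambda>x. \<exists>y\<in>set (l x). P x y)"
proof -
  have *: "(\<exists>y\<in>set (l x). P x y) \<longleftrightarrow> \<not> (\<forall>y\<in>set (l x). \<not> P x y)" for x
    by blast
  show ?thesis
    unfolding * by (intro effective_intro assms)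
qed

lemma effective_member [effective_intro]:
  assumes "effective f" "effective l"
  shows "effective (\<lambda>x. f x \<in> set (l x))"
proof -
  have *: "f x \<in> set (l x) \<longleftrightarrow> (\<exists>y\<in>set (l x). y = f x)" for x
    by blast
  show ?thesis
    unfolding * by (intro effective_intro assms effective_comp[OF assms(1)])
qed

text \<open>
  The second list is the state of a fold over the first. The state \<open>(False, [])\<close> for a second list
  that is too short is absorbing in its first component.
\<close>

lemma effective_list_all2 [effective_intro]:
  assumes "effective k" "effective l"
    and "effective (\<lambda>p. P (fst p) (fst (snd p)) (snd (snd p)))"
  shows "effective (\<lambda>x. list_all2 (\<lambda>y z. P x y z) (k x) (l x))"
proof -
  let ?step = "\<lambda>x s y. case snd s of [] \<Rightarrow> (False, []) | z # zs \<Rightarrow> (fst s \<and> P x y z, zs)"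
  have False: "\<not> fst (foldl (?step x) (False, zs) ys)" for x ys zs
    by (induction ys arbitrary: zs) (auto split: list.split)
  have "foldl (?step x) (True, zs) ys = (True, []) \<longleftrightarrow> list_all2 (P x) ys zs" for x ys zs
  proof (induction ys arbitrary: zs)
    case (Cons y ys)
    have "foldl (?step x) (False, zs) ys \<noteq> (True, [])" for zs
      using False[of x zs ys] by (metis fst_conv)
    with Cons show ?case
      by (cases zs; cases "P x y (hd zs)") simp_all
  qed auto
  then have *: "list_all2 (P x) (k x) (l x) \<longleftrightarrow> foldl (?step x) (True, l x) (k x) = (True, [])" for x
    by simp
  show ?thesis
    unfolding * by (intro effective_intro assms effective_comp3[OF assms(3)])
qed

lemma effective_sublist [effective_intro]:
  assumes "effective f" "effective g"
  shows "effective (\<lambda>x. sublist (f x) (g x))"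
proof -
  have *: "sublist u v \<longleftrightarrow> (\<exists>i<Suc (length v). take (length u) (drop i v) = u)" for u v :: "'b list"
  proof
    assume "sublist u v"
    then obtain p s where "v = p @ u @ s"
      by (auto simp: sublist_def)
    then show "\<exists>i<Suc (length v). take (length u) (drop i v) = u"
      by (intro exI[of _ "length p"]) simp
  next
    assume "\<exists>i<Suc (length v). take (length u) (drop i v) = u"
    then obtain i where "take (length u) (drop i v) = u" by blast
    then have "v = take i v @ u @ drop (length u) (drop i v)"
      by (metis append_take_drop_id)
    then show "sublist u v"
      unfolding sublist_def by blast
  qed
  show ?thesis
    unfolding *
    by (intro effective_intro assms effective_comp[OF assms(1)]
        effective_comp[OF assms(2)])
qed

section \<open>Coding programs and grammars\<close>

instantiation symbol :: coded_onto
begin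
definition encode_symbol :: "symbol \<Rightarrow> nat" where "encode_symbol = symbol_encode"
instance
proof (standard, goal_cases)
  case (1 x y)
  then show ?case
    by (cases x; cases y) (simp_all add: encode_symbol_def sum_encode_eq)
next
  case 2
  have "encode (case_sum NT Tm (sum_decode n)) = n" for n
    by (cases "sum_decode n") (simp_all add: encode_symbol_def flip: sum_decode_eq)
  then show ?case
    by (rule surjI)
qed
end

lemma effective_NT [effective_intro]: "effective f \<Longrightarrow> effective (\<lambda>x. NT (f x))"
  by (rule effective_transfer[of "\<lambda>x. f x + f x"])
    (intro effective_intro, simp_all add: encode_symbol_def sum_encode_def)

lemma effective_Tm [effective_intro]: "effective f \<Longrightarrow> effective (\<lambda>x. Tm (f x))"
  by (rule effective_transfer[of "\<lambda>x. Suc (f x + f x)"])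
    (intro effective_intro, simp_all add: encode_symbol_def sum_encode_def)

lemma effective_case_symbol [effective_intro]:
  assumes "effective s" "effective (\<lambda>p. f (fst p) (snd p))" "effective (\<lambda>p. g (fst p) (snd p))"
  shows "effective (\<lambda>x. case s x of NT A \<Rightarrow> f x A | Tm a \<Rightarrow> g x a)"
proof -
  let ?sum = "\<lambda>x. case s x of NT A \<Rightarrow> Inl A | Tm a \<Rightarrow> Inr a"
  have "effective ?sum"
    using assms(1) by (rule effective_transfer)
      (simp add: encode_symbol_def encode_sum_def split: symbol.split)
  then have "effective (\<lambda>x. case ?sum x of Inl A \<Rightarrow> f x A | Inr a \<Rightarrow> g x a)"
    by (rule effective_case_sum) (intro assms)+
  then show ?thesis
    by (rule effective_transfer) (simp split: symbol.split)
qed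

instantiation cfg :: coded_onto
begin
definition encode_cfg :: "cfg \<Rightarrow> nat" where "encode_cfg G = encode (start G, productions G)"
instance
proof (standard, goal_cases)
  case (1 x y)
  then show ?case
    by (cases x; cases y) (simp add: encode_cfg_def del: encode_Pair)
next
  case 2
  have "encode (case_prod CFG (decode n)) = n" for n
    by (simp add: encode_cfg_def case_prod_unfold del: encode_Pair)
  then show ?case
    by (rule surjI)
qed
end

lemma cfg_encode_eq_encode: "cfg_encode G = encode G"
proof (cases G)
  case (CFG s P)
  have "production_encode = encode"
    by (auto simp: fun_eq_iff encode_list_def encode_symbol_def cong: map_cong)
  with CFG show ?thesis
    by (simp add: encode_cfg_def encode_list_def)
qed

lemma effective_start [effective_intro]:
  assumes "effective G" shows "effective (\<lambda>x. start (G x))"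
proof -
  have "effective (\<lambda>x. (start (G x), productions (G x)))"
    using assms by (rule effective_transfer) (simp only: encode_cfg_def)
  from effective_fst[OF this] show ?thesis by simp
qed

lemma effective_productions [effective_intro]:
  assumes "effective G" shows "effective (\<lambda>x. productions (G x))"
proof -
  have "effective (\<lambda>x. (start (G x), productions (G x)))"
    using assms by (rule effective_transfer) (simp only: encode_cfg_def)
  from effective_snd[OF this] show ?thesis by simp
qed

lemma effective_CFG [effective_intro]:
  assumes "effective s" "effective P" shows "effective (\<lambda>x. CFG (s x) (P x))"
  using effective_Pair[OF assms] by (rule effective_transfer) (simp add: encode_cfg_def)

text \<open>
  Two cases without arguments and a fourfold sum for the remaining constructors make this code
  a bijection, so that programs can be found by searching through all numbers.
\<close>

primrec recf_encode :: "recf \<Rightarrow> nat" where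
  "recf_encode Zero = 0"
| "recf_encode Succ = 1"
| "recf_encode (Proj i) = Suc (Suc (sum_encode (Inl (sum_encode (Inl i)))))"
| "recf_encode (Cn f gs) = Suc (Suc (sum_encode (Inl (sum_encode (Inr
     (prod_encode (recf_encode f, list_encode (map recf_encode gs))))))))"
| "recf_encode (Pr f g) = Suc (Suc (sum_encode (Inr (sum_encode (Inl
     (prod_encode (recf_encode f, recf_encode g)))))))"
| "recf_encode (Mn f) = Suc (Suc (sum_encode (Inr (sum_encode (Inr (recf_encode f))))))"

lemma recf_encode_inject: "recf_encode p = recf_encode q \<Longrightarrow> p = q"
proof (induction p arbitrary: q)
  case (Cn f gs)
  then obtain f' gs' where q: "q = Cn f' gs'"
    by (cases q) (simp_all add: sum_encode_eq)
  have "gs = gs'"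
    by (rule list.inj_map_strong[of gs gs' recf_encode recf_encode])
      (use Cn q in \<open>simp_all add: sum_encode_eq list_encode_eq\<close>)
  with Cn q show ?case
    by (simp add: sum_encode_eq)
next
  case Zero
  then show ?case by (cases q) (simp_all add: sum_encode_eq)
next
  case Succ
  then show ?case by (cases q) (simp_all add: sum_encode_eq)
next
  case (Proj i)
  then show ?case by (cases q) (simp_all add: sum_encode_eq)
next
  case (Pr f g)
  then show ?case by (cases q) (simp_all add: sum_encode_eq)
next
  case (Mn f)
  then show ?case by (cases q) (simp_all add: sum_encode_eq)
qed

lemma member_less_list_encode: "x \<in> set xs \<Longrightarrow> x < list_encode xs"
proof (induction xs)
  case (Cons y ys)
  then show ?case
    using le_prod_encode_1[of y "list_encode ys"] le_prod_encode_2[of "list_encode ys" y] by auto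
qed simp

lemma le_sum_encode: "i \<le> sum_encode (Inl i)" "i \<le> sum_encode (Inr i)"
  by (simp_all add: sum_encode_def)

lemma recf_encode_surj: "\<exists>p. recf_encode p = n"
proof (induction n rule: less_induct)
  case (less n)
  consider "n = 0" | "n = 1" | m where "n = Suc (Suc m)"
    by (metis One_nat_def not0_implies_Suc)
  then show ?case
  proof cases
    case 1
    then show ?thesis by (intro exI[of _ Zero]) simp
  next
    case 2
    then show ?thesis by (intro exI[of _ Succ]) simp
  next
    case 3
    have split: "\<exists>i. k = sum_encode (Inl i) \<or> k = sum_encode (Inr i)" for k
      by (metis sum.exhaust sum_decode_inverse)
    obtain k where k: "m = sum_encode (Inl k) \<or> m = sum_encode (Inr k)" "k \<le> m"
      using split le_sum_encode by metis
    obtain i where i: "k = sum_encode (Inl i) \<or> k = sum_encode (Inr i)" "i \<le> k"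
      using split le_sum_encode by metis
    obtain a b where ab: "i = prod_encode (a, b)" "a \<le> i" "b \<le> i"
      by (metis le_prod_encode_1 le_prod_encode_2 prod_decode_inverse surj_pair)
    have small: "j < n" if "j \<le> i" for j
      using that 3 k(2) i(2) by simp
    obtain p q r where pqr: "recf_encode p = a" "recf_encode q = b" "recf_encode r = i"
      using less[OF small] ab by blast
    have "\<forall>j\<in>set (list_decode b). \<exists>s. recf_encode s = j"
      using less[OF small] member_less_list_encode[of _ "list_decode b"] ab(3)
      by (metis leD le_trans linorder_le_cases list_decode_inverse)
    then obtain d where d: "\<forall>j\<in>set (list_decode b). recf_encode (d j) = j"
      by metis
    then have "map recf_encode (map d (list_decode b)) = list_decode b"
      by (simp add: map_idI)
    then have gs: "list_encode (map recf_encode (map d (list_decode b))) = b"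
      by (metis list_decode_inverse)
    have "recf_encode (Proj i) = n \<or> recf_encode (Cn p (map d (list_decode b))) = n \<or>
        recf_encode (Pr p q) = n \<or> recf_encode (Mn r) = n"
      using k(1) i(1) ab(1) pqr gs 3 by (auto simp del: map_map)
    then show ?thesis by blast
  qed
qed

instantiation recf :: coded_onto
begin
definition encode_recf :: "recf \<Rightarrow> nat" where "encode_recf = recf_encode"
instance
proof
  show "p = q" if "encode p = encode q" for p q :: recf
    using that by (simp add: encode_recf_def recf_encode_inject)
  show "surj (encode :: recf \<Rightarrow> nat)"
    unfolding encode_recf_def surj_def using recf_encode_surj by metis
qed
end

text \<open>
  The sum type by which the constructors are coded has the same codes as the programs, so the
  destructors for sums and options apply.
\<close>

lemma effective_case_recf [effective_intro]:
  assumes "effective p" "effective a" "effective b" "effective (\<lambda>q. c (fst q) (snd q))"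
    "effective (\<lambda>q. d (fst q) (fst (snd q)) (snd (snd q)))"
    "effective (\<lambda>q. e (fst q) (fst (snd q)) (snd (snd q)))"
    "effective (\<lambda>q. f (fst q) (snd q))"
  shows "effective (\<lambda>x. case p x of Zero \<Rightarrow> a x | Succ \<Rightarrow> b x | Proj i \<Rightarrow> c x i | Cn g gs \<Rightarrow> d x g gs
    | Pr g h \<Rightarrow> e x g h | Mn g \<Rightarrow> f x g)"
proof -
  let ?shape = "\<lambda>x. case p x of Zero \<Rightarrow> None | Succ \<Rightarrow> Some None
    | Proj i \<Rightarrow> Some (Some (Inl (Inl i))) | Cn g gs \<Rightarrow> Some (Some (Inl (Inr (g, gs))))
    | Pr g h \<Rightarrow> Some (Some (Inr (Inl (g, h)))) | Mn g \<Rightarrow> Some (Some (Inr (Inr g)))"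
  have shape: "effective ?shape"
    using assms(1) by (rule effective_transfer)
      (simp add: encode_recf_def encode_sum_def encode_option_def encode_list_def split: recf.split)
  have "effective (\<lambda>x. case ?shape x of None \<Rightarrow> a x | Some s \<Rightarrow>
      (case s of None \<Rightarrow> b x | Some t \<Rightarrow>
        (case t of Inl u \<Rightarrow> (case u of Inl i \<Rightarrow> c x i | Inr q \<Rightarrow> d x (fst q) (snd q))
          | Inr u \<Rightarrow> (case u of Inl q \<Rightarrow> e x (fst q) (snd q) | Inr g \<Rightarrow> f x g))))"
    by (intro effective_case_option effective_case_sum shape effective_snd effective_fst effective_id
        assms effective_comp[OF assms(3)] effective_comp2[OF assms(4)] effective_comp3[OF assms(5)]
        effective_comp3[OF assms(6)] effective_comp2[OF assms(7)])
  then show ?thesis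
    by (rule effective_transfer) (simp split: recf.split)
qed

section \<open>Certificates\<close>

text \<open>
  An inductively defined set is given by a relation \<open>J C e\<close>: the facts in \<open>C\<close> justify the fact \<open>e\<close>. A
  certificate lists facts, each justified by those after it, and checking it is decidable if
  \<open>J\<close> is, although membership in the inductively defined set is in general only semidecidable.
\<close>

primrec certificate :: "('a list \<Rightarrow> 'a \<Rightarrow> bool) \<Rightarrow> 'a list \<Rightarrow> bool" where
  "certificate J [] = True"
| "certificate J (e # C) = (J C e \<and> certificate J C)"

definition certified :: "('a list \<Rightarrow> 'a \<Rightarrow> bool) \<Rightarrow> 'a \<Rightarrow> bool" where
  "certified J e \<longleftrightarrow> (\<exists>C. certificate J C \<and> e \<in> set C)"

lemma effective_certificate [effective_intro]:
  assumes "effective C" "effective (\<lambda>p. J (fst p) (fst (snd p)) (snd (snd p)))"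
  shows "effective (\<lambda>x. certificate (\<lambda>D e. J x D e) (C x))"
proof -
  have "certificate (J x) D = rec_list True (\<lambda>e D r. J x D e \<and> r) D" for x D
    by (induction D) auto
  then have *: "certificate (\<lambda>D e. J x D e) (C x) = rec_list True (\<lambda>e D r. J x D e \<and> r) (C x)" for x
    by metis
  show ?thesis
    unfolding * by (intro effective_intro assms effective_comp3[OF assms(2)])
qed

lemma certified_induct [consumes 1, case_names rule]:
  assumes "certified J e"
    and "\<And>C e. J C e \<Longrightarrow> (\<And>d. d \<in> set C \<Longrightarrow> P d) \<Longrightarrow> P e"
  shows "P e"
proof -
  have "\<forall>e\<in>set C. P e" if "certificate J C" for C
    using that by (induction C) (auto intro: assms(2))
  with assms(1) show ?thesis
    unfolding certified_def by blast
qed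

text \<open>
  Certificates for finitely many premises can be concatenated into one, as a monotone relation is
  not disturbed by additional facts.
\<close>

lemma certified_rule:
  assumes mono: "\<And>C D e. J C e \<Longrightarrow> set C \<subseteq> set D \<Longrightarrow> J D e"
    and "J D e" and "\<And>d. d \<in> set D \<Longrightarrow> certified J d"
  shows "certified J e"
proof -
  have append: "certificate J (C @ C')" if "certificate J C" "certificate J C'" for C C'
    using that by (induction C) (auto elim: mono)
  have "\<exists>C. certificate J C \<and> set D \<subseteq> set C"
    using assms(3)
  proof (induction D)
    case Nil
    show ?case by (intro exI[of _ "[]"]) simp
  next
    case (Cons d D)
    from Cons obtain C where C: "certificate J C" "set D \<subseteq> set C" by auto
    from Cons.prems obtain C' where C': "certificate J C'" "d \<in> set C'"
      unfolding certified_def by auto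
    from C C' show ?case
      by (intro exI[of _ "C @ C'"]) (auto intro: append)
  qed
  then obtain C where "certificate J C" "set D \<subseteq> set C" by blast
  with assms(2) have "certificate J (e # C)"
    by (auto elim: mono)
  then show ?thesis
    unfolding certified_def by (metis list.set_intros(1))
qed

text \<open>
  The witness is found by unbounded search. Here both codings have to be onto: every number
  that the search visits, and every input, has to stand for some value.
\<close>

lemma recursively_enumerable_projection:
  fixes Q :: "'a::coded_onto \<Rightarrow> 'b::coded_onto \<Rightarrow> bool"
  assumes "effective (\<lambda>p. Q (fst p) (snd p))"
  shows "recursively_enumerable {encode x | x. \<exists>y. Q x y}"
proof -
  have "effective (\<lambda>n. if Q (decode (snd n)) (decode (fst n)) then 0 else 1 :: nat)"
    by (intro effective_intro effective_comp2[OF assms])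
  then obtain h where "computable h"
    and h: "\<And>k n. h (prod_encode (k, n)) = (if Q (decode n) (decode k) then 0 else 1)"
    unfolding effective_def by fastforce
  then obtain p where p: "\<And>n. recf_eval p [n] = Some (h n)"
    unfolding computable_def by blast
  let ?test = "Cn p [pair_rf]"
  have test: "recf_eval ?test [k, n] = Some (if Q (decode n) (decode k) then 0 else 1)" for k n
    by (simp add: p h)
  have "recf_eval (Mn ?test) [n] \<noteq> None \<longleftrightarrow> (\<exists>k. Q (decode n) (decode k))" for n
    by (simp add: test del: recf_eval.simps(4))
  also have "(\<exists>k. Q (decode n) (decode k)) \<longleftrightarrow> n \<in> {encode x | x. \<exists>y. Q x y}" for n
    by (auto, metis encode_decode, metis decode_encode)
  finally show ?thesis
    unfolding recursively_enumerable_def by blast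
qed

section \<open>A universal computation relation\<close>

text \<open>
  A fact \<open>(p, xs, y)\<close> says that \<open>p\<close> has the value \<open>y\<close> on \<open>xs\<close>. Composition, recursion and search ask for
  the intermediate values in other facts of \<open>C\<close>, so all quantifiers are bounded and the relation is
  decidable. In the case of search, the facts for \<open>m < y\<close> have to record nonzero values,
  which makes \<open>y\<close> the least zero.
\<close>

definition evaluation_rule :: "(recf \<times> nat list \<times> nat) list \<Rightarrow> recf \<times> nat list \<times> nat \<Rightarrow> bool" where
  "evaluation_rule C = (\<lambda>(p, xs, y). case p of
     Zero \<Rightarrow> y = 0
   | Succ \<Rightarrow> (case xs of [] \<Rightarrow> False | x # _ \<Rightarrow> y = Suc x)
   | Proj i \<Rightarrow> (case drop i xs of [] \<Rightarrow> False | x # _ \<Rightarrow> y = x)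
   | Cn f gs \<Rightarrow> (\<exists>(f', ys, y')\<in>set C. f' = f \<and> y' = y \<and> list_all2 (\<lambda>g v. (g, xs, v) \<in> set C) gs ys)
   | Pr f g \<Rightarrow> (case xs of [] \<Rightarrow> False | n # zs \<Rightarrow>
       (case n of 0 \<Rightarrow> (f, zs, y) \<in> set C
        | Suc m \<Rightarrow> \<exists>(p', xs', v)\<in>set C. p' = p \<and> xs' = m # zs \<and> (g, m # v # zs, y) \<in> set C))
   | Mn f \<Rightarrow> (f, y # xs, 0) \<in> set C \<and>
       (\<forall>m<y. \<exists>(f', xs', v)\<in>set C. f' = f \<and> xs' = m # xs \<and> v \<noteq> 0))"

lemma effective_evaluation_rule [effective_intro]:
  assumes "effective C" "effective e"
  shows "effective (\<lambda>x. evaluation_rule (C x) (e x))"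
  unfolding evaluation_rule_def
  by (intro effective_intro effective_comp[OF assms(1)] effective_comp[OF assms(2)])

lemma evaluation_rule_mono:
  assumes "evaluation_rule C e" "set C \<subseteq> set D"
  shows "evaluation_rule D e"
proof -
  obtain p xs y where e: "e = (p, xs, y)" by (cases e)
  show ?thesis
  proof (cases p)
    case (Cn f gs)
    with e assms show ?thesis
      by (auto simp: evaluation_rule_def intro: list_all2_mono)
  next
    case (Pr f g)
    with e assms show ?thesis
      by (auto simp: evaluation_rule_def split: list.splits nat.splits)
  next
    case (Mn f)
    with e assms show ?thesis
      by (auto simp: evaluation_rule_def) blast
  qed (use e assms in \<open>auto simp: evaluation_rule_def\<close>)
qed

lemma those_eq_Some_iff: "those zs = Some ys \<longleftrightarrow> list_all2 (\<lambda>z y. z = Some y) zs ys"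
proof (induction zs arbitrary: ys)
  case (Cons z zs)
  then show ?case
    by (cases ys; cases z) auto
qed auto

lemma certified_evaluation_sound:
  assumes "certified evaluation_rule (p, xs, y)"
  shows "recf_eval p xs = Some y"
proof -
  have "(\<lambda>(p, xs, y). recf_eval p xs = Some y) e" if "certified evaluation_rule e" for e
    using that
  proof (induction rule: certified_induct)
    case (rule C e)
    obtain p xs y where e: "e = (p, xs, y)" by (cases e)
    have IH: "recf_eval q zs = Some v" if "(q, zs, v) \<in> set C" for q zs v
      using rule(2)[OF that] by simp
    have "recf_eval p xs = Some y"
    proof (cases p)
      case (Proj i)
      with rule(1) e obtain zs where "drop i xs = y # zs"
        by (auto simp: evaluation_rule_def split: list.splits)
      then have "i < length xs" "xs ! i = y"
        by (metis drop_all leI list.distinct(1), metis hd_drop_conv_nth drop_all leI list.distinct(1) list.sel(1))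
      with Proj show ?thesis by simp
    next
      case (Cn f gs)
      with rule(1) e obtain ys where ys: "(f, ys, y) \<in> set C"
        "list_all2 (\<lambda>g v. (g, xs, v) \<in> set C) gs ys"
        by (auto simp: evaluation_rule_def)
      then have "those (map (\<lambda>g. recf_eval g xs) gs) = Some ys"
        unfolding those_eq_Some_iff list_all2_map1
        by (auto elim!: list_all2_mono simp: IH)
      with Cn IH[OF ys(1)] show ?thesis by simp
    next
      case (Pr f g)
      with rule(1) e show ?thesis
        by (fastforce simp: evaluation_rule_def split: list.splits nat.splits dest!: IH)
    next
      case (Mn f)
      with rule(1) e have 0: "recf_eval f (y # xs) = Some 0"
        and less: "\<And>m. m < y \<Longrightarrow> \<exists>v. recf_eval f (m # xs) = Some v \<and> v \<noteq> 0"
        by (fastforce simp: evaluation_rule_def dest: IH)+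
      then have "(LEAST n. recf_eval f (n # xs) = Some 0) = y"
        by (intro Least_equality) (fastforce simp: not_less[symmetric])+
      with Mn 0 less show ?thesis by fastforce
    qed (use rule(1) e in \<open>auto simp: evaluation_rule_def split: list.splits\<close>)
    with e show ?case by simp
  qed
  with assms show ?thesis by fastforce
qed

lemma certified_evaluation_rule:
  assumes "evaluation_rule D e" "\<And>d. d \<in> set D \<Longrightarrow> certified evaluation_rule d"
  shows "certified evaluation_rule e"
  by (rule certified_rule[where D = D]) (use assms evaluation_rule_mono in blast)+

lemma certified_evaluation_complete:
  "recf_eval p xs = Some y \<Longrightarrow> certified evaluation_rule (p, xs, y)"
proof (induction p arbitrary: xs y)
  case Zero
  show ?case
    by (rule certified_evaluation_rule[of "[]"]) (use Zero in \<open>auto simp: evaluation_rule_def\<close>)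
next
  case Succ
  show ?case
    by (rule certified_evaluation_rule[of "[]"]) (use Succ in \<open>auto simp: evaluation_rule_def split: list.splits\<close>)
next
  case (Proj i)
  show ?case
    by (rule certified_evaluation_rule[of "[]"]) (use Proj in \<open>auto simp: evaluation_rule_def split: list.splits if_splits simp flip: Cons_nth_drop_Suc\<close>)
next
  case (Cn f gs)
  then obtain ys where "those (map (\<lambda>g. recf_eval g xs) gs) = Some ys" and f: "recf_eval f ys = Some y"
    by (auto simp: bind_eq_Some_conv)
  then have gs: "list_all2 (\<lambda>g v. recf_eval g xs = Some v) gs ys"
    by (simp add: those_eq_Some_iff list_all2_map1)
  let ?D = "(f, ys, y) # map (\<lambda>(g, v). (g, xs, v)) (zip gs ys)"
  have "evaluation_rule ?D (Cn f gs, xs, y)"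
    using gs by (force simp: evaluation_rule_def list_all2_iff)
  moreover have "certified evaluation_rule d" if "d \<in> set ?D" for d
    using that Cn.IH f gs by (fastforce simp: list_all2_iff dest: set_zip_leftD)
  ultimately show ?case
    by (rule certified_evaluation_rule)
next
  case (Pr f g)
  then obtain n zs where xs: "xs = n # zs"
    by (auto split: list.splits)
  have "certified evaluation_rule (Pr f g, n # zs, y)" if "recf_eval (Pr f g) (n # zs) = Some y" for n y
    using that
  proof (induction n arbitrary: y)
    case 0
    then have "certified evaluation_rule (f, zs, y)"
      by (intro Pr.IH) simp
    show ?case
      by (rule certified_evaluation_rule[of "[(f, zs, y)]"])
        (use \<open>certified evaluation_rule (f, zs, y)\<close> in \<open>auto simp: evaluation_rule_def\<close>)
  next
    case (Suc m)
    then obtain v where v: "recf_eval (Pr f g) (m # zs) = Some v" "recf_eval g (m # v # zs) = Some y"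
      by (auto simp: bind_eq_Some_conv)
    let ?D = "[(Pr f g, m # zs, v), (g, m # v # zs, y)]"
    have "evaluation_rule ?D (Pr f g, Suc m # zs, y)"
      by (simp add: evaluation_rule_def)
    moreover have "certified evaluation_rule d" if "d \<in> set ?D" for d
      using that Suc.IH[OF v(1)] Pr.IH(2)[OF v(2)] by auto
    ultimately show ?case
      by (rule certified_evaluation_rule)
  qed
  with xs Pr.prems show ?case by blast
next
  case (Mn f)
  then obtain n where n: "recf_eval f (n # xs) = Some 0" "\<forall>m<n. recf_eval f (m # xs) \<noteq> None"
    and y: "y = (LEAST n. recf_eval f (n # xs) = Some 0)"
    by (auto split: if_splits)
  have zero: "recf_eval f (y # xs) = Some 0"
    unfolding y using n(1) by (rule LeastI)
  have less: "\<exists>v. recf_eval f (m # xs) = Some v \<and> v \<noteq> 0" if "m < y" for m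
    using not_less_Least[OF that[unfolded y]] Least_le[of "\<lambda>n. recf_eval f (n # xs) = Some 0", OF n(1)] n(2) that y
    by (metis option.exhaust order_less_le_trans)
  then obtain v where v: "\<And>m. m < y \<Longrightarrow> recf_eval f (m # xs) = Some (v m) \<and> v m \<noteq> 0"
    by metis
  let ?D = "(f, y # xs, 0) # map (\<lambda>m. (f, m # xs, v m)) [0..<y]"
  have "evaluation_rule ?D (Mn f, xs, y)"
    using v by (fastforce simp: evaluation_rule_def)
  moreover have "certified evaluation_rule d" if "d \<in> set ?D" for d
    using that zero v by (auto intro: Mn.IH)
  ultimately show ?case
    by (rule certified_evaluation_rule)
qed

definition halting_certificate :: "recf \<times> nat \<Rightarrow> (recf \<times> nat list \<times> nat) list \<Rightarrow> bool" where
  "halting_certificate e C \<longleftrightarrow>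
     certificate evaluation_rule C \<and> (\<exists>(p, xs, y)\<in>set C. p = fst e \<and> xs = [snd e])"

text \<open>
  A universal decidable relation: the halting problem is its projection.
\<close>

lemma halting_certificate_iff:
  "(\<exists>C. halting_certificate (p, n) C) \<longleftrightarrow> recf_eval p [n] \<noteq> None"
proof -
  have "(\<exists>C. halting_certificate (p, n) C) \<longleftrightarrow> (\<exists>y. certified evaluation_rule (p, [n], y))"
    unfolding halting_certificate_def certified_def by fastforce
  then show ?thesis
    using certified_evaluation_sound certified_evaluation_complete by (metis not_None_eq)
qed

lemma effective_halting_certificate [effective_intro]:
  assumes "effective e" "effective C"
  shows "effective (\<lambda>x. halting_certificate (e x) (C x))"
  unfolding halting_certificate_def
  by (intro effective_intro effective_comp[OF assms(1)] effective_comp[OF assms(2)])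

section \<open>Context-free derivations\<close>

definition derivation_rule :: "cfg \<Rightarrow> symbol list list \<Rightarrow> symbol list \<Rightarrow> bool" where
  "derivation_rule G C \<beta> \<longleftrightarrow> \<beta> = [NT (start G)] \<or>
     (\<exists>\<alpha>\<in>set C. \<exists>(A, r)\<in>set (productions G). \<exists>i<length \<alpha>.
        (case drop i \<alpha> of [] \<Rightarrow> False | s # v \<Rightarrow>
          (case s of NT B \<Rightarrow> B = A \<and> \<beta> = take i \<alpha> @ r @ v | Tm a \<Rightarrow> False)))"

lemma derivation_rule_iff:
  "derivation_rule G C \<beta> \<longleftrightarrow> \<beta> = [NT (start G)] \<or> (\<exists>\<alpha>\<in>set C. derive1 G \<alpha> \<beta>)"
proof -
  have "derive1 G \<alpha> \<beta> \<longleftrightarrow> (\<exists>(A, r)\<in>set (productions G). \<exists>i<length \<alpha>.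
      (case drop i \<alpha> of [] \<Rightarrow> False | s # v \<Rightarrow>
        (case s of NT B \<Rightarrow> B = A \<and> \<beta> = take i \<alpha> @ r @ v | Tm a \<Rightarrow> False)))" for \<alpha>
  proof
    assume "derive1 G \<alpha> \<beta>"
    then obtain A r u v where "(A, r) \<in> set (productions G)" "\<alpha> = u @ [NT A] @ v" "\<beta> = u @ r @ v"
      by cases
    then show "\<exists>(A, r)\<in>set (productions G). \<exists>i<length \<alpha>.
      (case drop i \<alpha> of [] \<Rightarrow> False | s # v \<Rightarrow>
        (case s of NT B \<Rightarrow> B = A \<and> \<beta> = take i \<alpha> @ r @ v | Tm a \<Rightarrow> False))"
      by (intro bexI[of _ "(A, r)"]) (auto intro: exI[of _ "length u"])
  next
    assume "\<exists>(A, r)\<in>set (productions G). \<exists>i<length \<alpha>.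
      (case drop i \<alpha> of [] \<Rightarrow> False | s # v \<Rightarrow>
        (case s of NT B \<Rightarrow> B = A \<and> \<beta> = take i \<alpha> @ r @ v | Tm a \<Rightarrow> False))"
    then obtain A r i where "(A, r) \<in> set (productions G)"
      and *: "case drop i \<alpha> of [] \<Rightarrow> False | s # v \<Rightarrow>
        (case s of NT B \<Rightarrow> B = A \<and> \<beta> = take i \<alpha> @ r @ v | Tm a \<Rightarrow> False)"
      by blast
    moreover from * obtain v where "drop i \<alpha> = NT A # v" "\<beta> = take i \<alpha> @ r @ v"
      by (auto split: list.split_asm symbol.split_asm)
    moreover from this(1) have "\<alpha> = take i \<alpha> @ [NT A] @ v"
      by (metis append_Cons append_Nil append_take_drop_id)
    ultimately show "derive1 G \<alpha> \<beta>"
      by (metis derive1.intros)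
  qed
  then show ?thesis
    unfolding derivation_rule_def by simp
qed

lemma effective_derivation_rule [effective_intro]:
  assumes "effective G" "effective C" "effective b"
  shows "effective (\<lambda>x. derivation_rule (G x) (C x) (b x))"
  unfolding derivation_rule_def
  by (intro effective_intro effective_comp[OF assms(1)] effective_comp[OF assms(2)]
      effective_comp[OF assms(3)])

lemma certified_derivation_iff:
  "certified (derivation_rule G) \<beta> \<longleftrightarrow> (derive1 G)\<^sup>*\<^sup>* [NT (start G)] \<beta>"
proof
  show "(derive1 G)\<^sup>*\<^sup>* [NT (start G)] \<beta>" if "certified (derivation_rule G) \<beta>"
    using that
    by (induction rule: certified_induct) (auto simp: derivation_rule_iff intro: rtranclp.rtrancl_into_rtrancl)
  have mono: "derivation_rule G D e" if "derivation_rule G C e" "set C \<subseteq> set D" for C D e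
    using that by (auto simp: derivation_rule_iff)
  show "certified (derivation_rule G) \<beta>" if "(derive1 G)\<^sup>*\<^sup>* [NT (start G)] \<beta>"
    using that
  proof (induction rule: rtranclp_induct)
    case base
    show ?case
      by (rule certified_rule[where D = "[]"]) (use mono in \<open>auto simp: derivation_rule_iff\<close>)
  next
    case (step \<alpha> \<beta>)
    show ?case
      by (rule certified_rule[where D = "[\<alpha>]"]) (use step mono in \<open>auto simp: derivation_rule_iff\<close>)
  qed
qed

text \<open>
  Model checking a decidable language is semidecidable: guess a word together with a certificate
  that contains its derivation from the start symbol.
\<close>

lemma recursively_enumerable_cfg_meets:
  fixes K :: "nat list \<Rightarrow> bool" and S :: "nat list"
  assumes "effective K"
  shows "recursively_enumerable {cfg_encode G | G. cfg_over (set S) G \<and> (\<exists>w\<in>cfg_language G. K w)}"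
proof -
  let ?Q = "\<lambda>G (y :: nat list \<times> symbol list list).
    (\<forall>(A, r)\<in>set (productions G). \<forall>s\<in>set r. case s of NT B \<Rightarrow> True | Tm a \<Rightarrow> a \<in> set S) \<and>
    K (fst y) \<and> certificate (derivation_rule G) (snd y) \<and> map Tm (fst y) \<in> set (snd y)"
  have "effective (\<lambda>p. ?Q (fst p) (snd p))"
    by (intro effective_intro effective_comp[OF assms])
  then have "recursively_enumerable {encode G | G. \<exists>y. ?Q G y}"
    by (rule recursively_enumerable_projection)
  moreover have "(\<exists>y. ?Q G y) \<longleftrightarrow> cfg_over (set S) G \<and> (\<exists>w\<in>cfg_language G. K w)" for G
  proof -
    have "cfg_over (set S) G \<longleftrightarrow>
        (\<forall>(A, r)\<in>set (productions G). \<forall>s\<in>set r. case s of NT B \<Rightarrow> True | Tm a \<Rightarrow> a \<in> set S)"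
      unfolding cfg_over_def by (auto split: symbol.splits)
    moreover have "w \<in> cfg_language G \<longleftrightarrow>
        (\<exists>C. certificate (derivation_rule G) C \<and> map Tm w \<in> set C)" for w
      unfolding cfg_language_def mem_Collect_eq certified_derivation_iff[symmetric]
      by (rule certified_def)
    ultimately show ?thesis by auto
  qed
  ultimately show ?thesis
    by (simp add: cfg_encode_eq_encode)
qed

section \<open>Towers of interleaved words\<close>

text \<open>
  The separators \<open>ss\<close> are placed one by one in the gaps between \<open>length ss + 1\<close> copies of \<open>w\<close>.
\<close>

definition weave :: "'a list \<Rightarrow> 'a list \<Rightarrow> 'a list" where
  "weave w ss = w @ concat (map (\<lambda>s. s # w) ss)"

primrec tower :: "(nat \<Rightarrow> 'a list) \<Rightarrow> nat \<Rightarrow> 'a list" where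
  "tower b 0 = []"
| "tower b (Suc k) = weave (tower b k) (b k)"

lemma weave_Nil [simp]: "weave w [] = w"
  by (simp add: weave_def)

lemma weave_Cons: "weave w (s # ss) = w @ s # weave w ss"
  by (simp add: weave_def)

lemma weave_append: "weave w (ss @ t # ts) = weave w ss @ t # weave w ts"
  by (simp add: weave_def)

text \<open>
  Weaving is associative. This is why a high level of a tower is also woven from each lower level.
\<close>

lemma weave_weave: "weave (weave w ss) ts = weave w (weave ss ts)"
  by (induction ts) (simp_all add: weave_Cons weave_append)

lemma prefix_weave: "prefix w (weave w ss)"
  by (simp add: weave_def)

lemma suffix_weave: "suffix w (weave w ss)"
proof (induction ss)
  case (Cons s ss)
  then show ?case
    by (auto simp: weave_Cons suffix_def)
qed simp

lemma set_weave: "set (weave w ss) \<subseteq> set w \<union> set ss"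
  by (auto simp: weave_def)

lemma length_weave: "Suc (length (weave w ss)) = Suc (length ss) * Suc (length w)"
  by (induction ss) (simp_all add: weave_Cons algebra_simps)

text \<open>
  A word that is longer than \<open>w\<close> by at most one letter meets at most one separator.
\<close>

lemma short_sublist_weave:
  assumes "sublist u (weave w ss)" "length u \<le> Suc (length w)"
  shows "sublist u w \<or> (\<exists>s\<in>set ss. sublist u (w @ s # w))"
  using assms
proof (induction ss)
  case (Cons s ss)
  then have "sublist u ((w @ [s]) @ weave w ss)"
    by (simp add: weave_Cons)
  then consider "sublist u (w @ [s])" | "sublist u (weave w ss)"
    | x y where "u = x @ y" "x \<noteq> []" "suffix x (w @ [s])" "prefix y (weave w ss)"
    unfolding sublist_append by (metis append_Nil prefix_imp_sublist)
  then show ?case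
  proof cases
    case 1
    then have "sublist u ((w @ [s]) @ w)"
      unfolding sublist_append by blast
    then show ?thesis by simp
  next
    case 2
    then show ?thesis using Cons by auto
  next
    case 3
    then have "length y \<le> length w"
      using Cons.prems(2) by (cases x) auto
    then have "prefix y w"
      using 3(4) prefix_weave prefix_length_prefix by blast
    with 3 have "sublist u ((w @ [s]) @ w)"
      unfolding sublist_append by blast
    then show ?thesis by simp
  qed
qed simp

text \<open>
  Copies of \<open>w\<close> start at distance \<open>length w + 1\<close>, so a window of twice the length of \<open>w\<close> plus one cannot
  avoid covering one of them.
\<close>

lemma long_sublist_weave:
  assumes "sublist u (weave w ss)" "2 * length w < length u"
  shows "sublist w u"
  using assms
proof (induction ss)
  case Nil
  then show ?case
    by (auto dest: sublist_length_le)
next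
  case (Cons s ss)
  then have "sublist u ((w @ [s]) @ weave w ss)"
    by (simp add: weave_Cons)
  then consider "sublist u (w @ [s])" | "sublist u (weave w ss)"
    | x y where "u = x @ y" "suffix x (w @ [s])" "prefix y (weave w ss)"
    unfolding sublist_append by blast
  then show ?case
  proof cases
    case 1
    then have "length u \<le> Suc (length w)"
      using sublist_length_le by fastforce
    with Cons.prems(2) have "length w = 0"
      by linarith
    then have "w = []"
      by simp
    then show ?thesis by simp
  next
    case 2
    then show ?thesis using Cons by simp
  next
    case 3
    then have "length x \<le> Suc (length w)"
      by (auto dest: suffix_length_le)
    then have "length w \<le> length y"
      using 3(1) Cons.prems(2) by simp
    then have "prefix w y"
      using 3(3) prefix_weave prefix_length_prefix by blast
    then show ?thesis
      using 3(1) by (auto simp: sublist_append dest: prefix_imp_sublist)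
  qed
qed

section \<open>Subwords of bi-infinite sequences\<close>

lemma length_subword_at [simp]: "length (subword_at x i n) = n"
  by (simp add: subword_at_def)

lemma nth_subword_at [simp]: "j < n \<Longrightarrow> subword_at x i n ! j = x (i + int j)"
  by (simp add: subword_at_def)

lemma subword_at_add: "subword_at x i (m + n) = subword_at x i m @ subword_at x (i + int m) n"
  by (rule nth_equalityI) (auto simp: nth_append algebra_simps)

lemma sublist_subword_at:
  assumes "i \<le> j" "j + int m \<le> i + int n"
  shows "sublist (subword_at x j m) (subword_at x i n)"
proof -
  define a b where "a = nat (j - i)" and "b = nat (i + int n - j - int m)"
  with assms have "n = a + (m + b)" "j = i + int a" by auto
  then have "subword_at x i n = subword_at x i a @ subword_at x j m @ subword_at x (j + int m) b"
    by (simp add: subword_at_add)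
  then show ?thesis
    unfolding sublist_def by blast
qed

lemma sublist_subword_atE:
  assumes "sublist u (subword_at x i n)"
  obtains j where "i \<le> j" "u = subword_at x j (length u)"
proof -
  obtain p s where eq: "subword_at x i n = p @ u @ s"
    using assms by (auto simp: sublist_def)
  have len: "n = length p + length u + length s"
    using arg_cong[OF eq, of length] by simp
  have "u = subword_at x (i + int (length p)) (length u)"
  proof (rule nth_equalityI)
    fix j assume "j < length u"
    then have "u ! j = subword_at x i n ! (length p + j)"
      by (simp add: eq nth_append)
    also have "\<dots> = subword_at x (i + int (length p)) (length u) ! j"
      using \<open>j < length u\<close> len by (simp add: algebra_simps)
    finally show "u ! j = subword_at x (i + int (length p)) (length u) ! j" .
  qed simp
  then show ?thesis
    using that[of "i + int (length p)"] by simp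
qed

lemma shift_funpow: "(shift ^^ n) x = (\<lambda>i. x (i + int n))"
  by (induction n) (simp_all add: shift_def algebra_simps)

lemma subword_at_shift: "subword_at (shift x) i n = subword_at x (i + 1) n"
  by (simp add: subword_at_def shift_def algebra_simps)

lemma topspace_full_shift: "x \<in> topspace (full_shift S) \<longleftrightarrow> (\<forall>i. x i \<in> S)"
  by (auto simp: full_shift_def PiE_def Pi_def)

lemma openin_cylinder:
  "openin (full_shift S) {x \<in> topspace (full_shift S). subword_at x i n = v}"
proof -
  let ?T = "topspace (full_shift S)"
  have coord: "openin (full_shift S) {x \<in> ?T. x j = a}" for j a
  proof -
    have "continuous_map (full_shift S) (discrete_topology S) (\<lambda>x. x j)"
      unfolding full_shift_def by (rule continuous_map_product_projection) simp
    then have "openin (full_shift S) {x \<in> ?T. x j \<in> {a} \<inter> S}"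
      by (rule openin_continuous_map_preimage) simp
    moreover have "{x \<in> ?T. x j \<in> {a} \<inter> S} = {x \<in> ?T. x j = a}"
      by (auto simp: topspace_full_shift)
    ultimately show ?thesis by simp
  qed
  show ?thesis
  proof (induction n arbitrary: v)
    case 0
    have "{x \<in> ?T. subword_at x i 0 = v} = (if v = [] then ?T else {})"
      by (auto simp: subword_at_def)
    then show ?case by simp
  next
    case (Suc n)
    have "subword_at x i (Suc n) = v \<longleftrightarrow>
        v \<noteq> [] \<and> subword_at x i n = butlast v \<and> x (i + int n) = last v" for x
      by (cases v rule: rev_cases) (auto simp: subword_at_def)
    then have "{x \<in> ?T. subword_at x i (Suc n) = v} = (if v = [] then {} else
        {x \<in> ?T. subword_at x i n = butlast v} \<inter> {x \<in> ?T. x (i + int n) = last v})"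
      by auto
    then show ?case
      using Suc coord by auto
  qed
qed

text \<open>
  An open set of the product topology restricts only finitely many coordinates, and these lie in
  one interval.
\<close>

lemma openin_full_shift_subword:
  assumes "openin (full_shift S) U" "x \<in> U"
  obtains i n where "\<And>y. y \<in> topspace (full_shift S) \<Longrightarrow> subword_at y i n = subword_at x i n \<Longrightarrow> y \<in> U"
proof -
  from assms obtain V where fin: "finite {i. V i \<noteq> S}" and x: "x \<in> PiE UNIV V"
    and sub: "PiE UNIV V \<subseteq> U"
    unfolding full_shift_def openin_product_topology_alt by force
  obtain N where N: "\<And>i. V i \<noteq> S \<Longrightarrow> \<bar>i\<bar> \<le> int N"
  proof -
    have "finite ((\<lambda>i. nat \<bar>i\<bar>) ` {i. V i \<noteq> S})"
      using fin by simp
    then obtain N where "\<forall>m\<in>(\<lambda>i. nat \<bar>i\<bar>) ` {i. V i \<noteq> S}. m \<le> N"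
      using finite_nat_set_iff_bounded_le by blast
    then show ?thesis
      using that[of N] by (auto simp: nat_le_iff)
  qed
  show ?thesis
  proof (rule that[of "- int N" "Suc (2 * N)"])
    fix y assume y: "y \<in> topspace (full_shift S)"
      "subword_at y (- int N) (Suc (2 * N)) = subword_at x (- int N) (Suc (2 * N))"
    have "y i \<in> V i" for i
    proof (cases "V i = S")
      case True
      with y show ?thesis by (simp add: topspace_full_shift)
    next
      case False
      define j where "j = nat (i + int N)"
      have j: "j < Suc (2 * N)" "i = - int N + int j"
        using N[OF False] by (auto simp: j_def)
      from y(2) have "subword_at y (- int N) (Suc (2 * N)) ! j = subword_at x (- int N) (Suc (2 * N)) ! j"
        by simp
      with j have "y i = x i" by simp
      with x show ?thesis by (auto simp: PiE_def Pi_def)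
    qed
    with sub show "y \<in> U" by (auto simp: PiE_def Pi_def)
  qed
qed

section \<open>The minimal subshift of a tower\<close>

text \<open>
  The letters of the \<open>k\<close>-th level form the word \<open>b k\<close>. That all of \<open>S\<close> occurs at every level
  bounds the level at which a word has to be looked for: each word \<open>W k @ s # W k\<close> occurs at the next level already.
\<close>

locale separator_sequence =
  fixes b :: "nat \<Rightarrow> 'a list" and S :: "'a set"
  assumes set_b: "set (b k) = S" and letters: "S \<noteq> {}"
begin

abbreviation W :: "nat \<Rightarrow> 'a list" where "W \<equiv> tower b"

definition tower_shift :: "(int \<Rightarrow> 'a) set" where
  "tower_shift = {x. \<forall>i n. \<exists>k. sublist (subword_at x i n) (W k)}"

lemma finite_S: "finite S"
  using set_b[of 0] by (metis List.finite_set)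

lemma set_tower: "set (W k) \<subseteq> S"
  by (induction k) (use set_weave set_b in fastforce)+

lemma tower_weave:
  assumes "j \<le> k"
  obtains ss where "set ss \<subseteq> S" "W k = weave (W j) ss"
proof -
  from assms have "\<exists>ss. set ss \<subseteq> S \<and> W k = weave (W j) ss"
  proof (induction rule: dec_induct)
    case base
    show ?case by (intro exI[of _ "[]"]) simp
  next
    case (step k)
    then obtain ss where ss: "set ss \<subseteq> S" "W k = weave (W j) ss" by blast
    have "set (weave ss (b k)) \<subseteq> S"
      using ss(1) set_b[of k] set_weave[of ss "b k"] by blast
    with ss(2) show ?case
      by (intro exI[of _ "weave ss (b k)"]) (simp add: weave_weave)
  qed
  then show ?thesis using that by blast
qed

lemma tower_mono:
  assumes "j \<le> k"
  shows "prefix (W j) (W k)" "suffix (W j) (W k)"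
  using tower_weave[OF assms] prefix_weave suffix_weave by metis+

lemma le_length_tower: "k \<le> length (W k)"
proof (induction k)
  case (Suc k)
  have "b k \<noteq> []"
    using set_b[of k] letters by auto
  then have "Suc 1 * Suc (length (W k)) \<le> Suc (length (W (Suc k)))"
    unfolding tower.simps length_weave by (intro mult_right_mono) (simp_all add: Suc_le_eq)
  with Suc show ?case by simp
qed simp

lemma sublist_tower_Suc:
  assumes "s \<in> S"
  shows "sublist (W k @ s # W k) (W (Suc k))"
proof -
  from assms obtain p q where "b k = p @ s # q"
    by (metis set_b split_list)
  then have W: "W (Suc k) = weave (W k) p @ s # weave (W k) q"
    by (simp add: weave_append)
  obtain u where u: "weave (W k) p = u @ W k"
    using suffix_weave by (metis suffixE)
  obtain v where v: "weave (W k) q = W k @ v"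
    using prefix_weave by (metis prefixE)
  have "W (Suc k) = u @ (W k @ s # W k) @ v"
    using W u v by simp
  then show ?thesis
    unfolding sublist_def by blast
qed

text \<open>
  A word \<open>u\<close> is at most as long as \<open>W (length u)\<close>. Whichever level it occurs at, it therefore lies
  within two neighbouring copies of that word, and any two neighbouring copies, with any letter between
  them, occur one level above.
\<close>

lemma sublist_tower_iff: "(\<exists>k. sublist u (W k)) \<longleftrightarrow> sublist u (W (Suc (length u)))"
proof
  let ?n = "length u"
  assume "\<exists>k. sublist u (W k)"
  then obtain k where "sublist u (W k)" by blast
  then have "sublist u (W (k + ?n))"
    using tower_mono(1)[of k "k + ?n"] by (meson le_add1 prefix_imp_sublist sublist_order.order.trans)
  moreover obtain ss where ss: "set ss \<subseteq> S" "W (k + ?n) = weave (W ?n) ss"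
    using tower_weave[of ?n "k + ?n"] by auto
  ultimately have "sublist u (W ?n) \<or> (\<exists>s\<in>set ss. sublist u (W ?n @ s # W ?n))"
    using le_length_tower[of ?n] by (intro short_sublist_weave) simp_all
  moreover have "sublist (W ?n) (W (Suc ?n))"
    by (rule prefix_imp_sublist) (rule tower_mono, simp)
  ultimately show "sublist u (W (Suc ?n))"
    using ss(1) sublist_tower_Suc by (meson subsetD sublist_order.order.trans)
qed blast

lemma tower_shift_letters: "x \<in> tower_shift \<Longrightarrow> x i \<in> S"
proof -
  assume "x \<in> tower_shift"
  then obtain k where "sublist (subword_at x i 1) (W k)"
    unfolding tower_shift_def by blast
  then have "set (subword_at x i 1) \<subseteq> S"
    using set_mono_sublist set_tower by blast
  then show ?thesis
    by (simp add: subword_at_def)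
qed

lemma subshift_tower_shift: "subshift S tower_shift"
  unfolding subshift_def
proof (intro conjI finite_S)
  let ?T = "topspace (full_shift S)"
  have "tower_shift \<subseteq> ?T"
    using tower_shift_letters by (auto simp: topspace_full_shift)
  moreover have "?T - tower_shift =
      (\<Union>i. \<Union>n. \<Union>v\<in>{v. \<nexists>k. sublist v (W k)}. {x \<in> ?T. subword_at x i n = v})"
    unfolding tower_shift_def by auto
  then have "openin (full_shift S) (?T - tower_shift)"
    using openin_cylinder by (auto intro!: openin_clauses(3))
  ultimately show "closedin (full_shift S) tower_shift"
    by (simp add: closedin_def)
  show "shift ` tower_shift = tower_shift"
  proof
    show "shift ` tower_shift \<subseteq> tower_shift"
      by (auto simp: tower_shift_def subword_at_shift)
    show "tower_shift \<subseteq> shift ` tower_shift"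
    proof
      fix x assume x: "x \<in> tower_shift"
      let ?y = "\<lambda>i. x (i - 1)"
      have "subword_at ?y i n = subword_at x (i - 1) n" for i n
        by (simp add: subword_at_def algebra_simps)
      with x have "?y \<in> tower_shift"
        by (simp add: tower_shift_def)
      moreover have "x = shift ?y"
        by (simp add: shift_def)
      ultimately show "x \<in> shift ` tower_shift" by blast
    qed
  qed
qed

text \<open>
  If a nonempty subshift \<open>Y\<close> misses a point \<open>x\<close>, then it misses every point that agrees with \<open>x\<close> on
  some window. The word in this window lies in some \<open>W k\<close>, which occurs in every point of the tower
  shift, in particular in a point of \<open>Y\<close>; shifting that point brings the word to the window.
\<close>

lemma minimal_tower_shift: "minimal_subshift S tower_shift"
  unfolding minimal_subshift_def
proof (intro conjI allI impI subshift_tower_shift)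
  fix Y assume Y: "subshift S Y \<and> Y \<subseteq> tower_shift"
  show "Y = {} \<or> Y = tower_shift"
  proof (rule ccontr)
    assume "\<not> ?thesis"
    then obtain x y where x: "x \<in> tower_shift" "x \<notin> Y" and y: "y \<in> Y"
      using Y by blast
    have "openin (full_shift S) (topspace (full_shift S) - Y)"
      using Y unfolding subshift_def closedin_def by blast
    moreover have "x \<in> topspace (full_shift S) - Y"
      using x tower_shift_letters by (simp add: topspace_full_shift)
    ultimately obtain i n where cyl: "\<And>z. z \<in> topspace (full_shift S) \<Longrightarrow>
        subword_at z i n = subword_at x i n \<Longrightarrow> z \<in> topspace (full_shift S) - Y"
      by (metis openin_full_shift_subword)
    obtain k where k: "sublist (subword_at x i n) (W k)"
      using x(1) unfolding tower_shift_def by blast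
    let ?m = "Suc (2 * length (W k))"
    obtain l where l: "sublist (subword_at y i ?m) (W l)"
      using y Y unfolding tower_shift_def by blast
    have "sublist (W l) (W (k + l))"
      by (rule prefix_imp_sublist) (rule tower_mono, simp)
    with l have "sublist (subword_at y i ?m) (W (k + l))"
      by (rule sublist_order.order.trans)
    moreover obtain ss where "W (k + l) = weave (W k) ss"
      using tower_weave[of k "k + l"] by auto
    ultimately have "sublist (W k) (subword_at y i ?m)"
      using long_sublist_weave[of "subword_at y i ?m" "W k" ss] by simp
    with k have "sublist (subword_at x i n) (subword_at y i ?m)"
      by (rule sublist_order.order.trans)
    then obtain j where "i \<le> j" "subword_at x i n = subword_at y j (length (subword_at x i n))"
      by (rule sublist_subword_atE)
    then have j: "i \<le> j" "subword_at x i n = subword_at y j n"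
      by simp_all
    let ?z = "(shift ^^ nat (j - i)) y"
    have "(shift ^^ m) y \<in> Y" for m
      using Y y by (induction m) (auto simp: subshift_def)
    moreover have "?z \<in> topspace (full_shift S)"
      using Y y tower_shift_letters by (auto simp: topspace_full_shift shift_funpow)
    moreover have "subword_at ?z i n = subword_at x i n"
      using j by (simp add: shift_funpow subword_at_def algebra_simps)
    ultimately show False
      using cyl by blast
  qed
qed

text \<open>
  As \<open>W j\<close> is both a prefix and a suffix of \<open>W k\<close> for \<open>j \<le> k\<close>, the words \<open>centered k\<close> extend each other in
  both directions around their middle letter. Their limit is a point of the tower shift, with the
  middle letter at position 0, and it contains every \<open>W k\<close>.
\<close>

definition centered :: "nat \<Rightarrow> 'a list" where
  "centered k = W k @ (SOME s. s \<in> S) # W k"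

lemma sublist_centered: "sublist (centered k) (W (Suc k))"
  unfolding centered_def using letters by (intro sublist_tower_Suc) (simp add: some_in_eq)

text \<open>
  The middle letter of \<open>centered k\<close> has at least \<open>k\<close> letters on either side, so level \<open>\<bar>i\<bar>\<close> covers
  position \<open>i\<close>.
\<close>

definition tower_point :: "int \<Rightarrow> 'a" where
  "tower_point i = (let k = nat \<bar>i\<bar> in centered k ! nat (i + int (length (W k))))"

lemma centered_nth:
  assumes "j \<le> k" "\<bar>i\<bar> \<le> int (length (W j))"
  shows "centered k ! nat (i + int (length (W k))) = centered j ! nat (i + int (length (W j)))"
proof -
  obtain p where p: "W k = W j @ p"
    using tower_mono(1)[OF assms(1)] by (auto simp: prefix_def)
  obtain q where q: "W k = q @ W j"
    using tower_mono(2)[OF assms(1)] by (auto simp: suffix_def)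
  have "centered k = q @ centered j @ p"
    using p q by (metis append.assoc append_Cons centered_def)
  moreover have "nat (i + int (length (W k))) = length q + nat (i + int (length (W j)))"
    using assms(2) unfolding q by auto
  moreover have "nat (i + int (length (W j))) < length (centered j)"
    using assms(2) by (simp add: centered_def)
  ultimately show ?thesis
    by (simp add: nth_append)
qed

lemma tower_point_eq:
  assumes "\<bar>i\<bar> \<le> int (length (W k))"
  shows "tower_point i = centered k ! nat (i + int (length (W k)))"
proof -
  have "\<bar>i\<bar> \<le> int (length (W (nat \<bar>i\<bar>)))"
    using le_length_tower[of "nat \<bar>i\<bar>"] by linarith
  with assms show ?thesis
    unfolding tower_point_def Let_def by (metis centered_nth nle_le)
qed

lemma subword_at_tower_point:
  "subword_at tower_point (- int (length (W k))) (Suc (2 * length (W k))) = centered k"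
proof (rule nth_equalityI)
  fix j assume "j < length (subword_at tower_point (- int (length (W k))) (Suc (2 * length (W k))))"
  then have j: "j < Suc (2 * length (W k))" by simp
  then show "subword_at tower_point (- int (length (W k))) (Suc (2 * length (W k))) ! j = centered k ! j"
    by (simp add: tower_point_eq[of _ k] abs_le_iff)
qed (simp add: centered_def)

lemma tower_point_in: "tower_point \<in> tower_shift"
  unfolding tower_shift_def
proof (intro CollectI allI)
  fix i n
  define k where "k = nat \<bar>i\<bar> + n"
  have "sublist (subword_at tower_point i n)
      (subword_at tower_point (- int (length (W k))) (Suc (2 * length (W k))))"
    using le_length_tower[of k] by (intro sublist_subword_at) (auto simp: k_def)
  then show "\<exists>k. sublist (subword_at tower_point i n) (W k)"
    unfolding subword_at_tower_point using sublist_centered sublist_order.order.trans by blast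
qed

lemma language_tower_shift: "u \<in> language tower_shift \<longleftrightarrow> (\<exists>k. sublist u (W k))"
proof
  show "\<exists>k. sublist u (W k)" if "u \<in> language tower_shift"
    using that unfolding language_def tower_shift_def by blast
next
  assume "\<exists>k. sublist u (W k)"
  then obtain k where "sublist u (W k)" by blast
  moreover have "sublist (W k) (centered k)"
    by (simp add: centered_def sublist_append)
  ultimately have "sublist u (subword_at tower_point (- int (length (W k))) (Suc (2 * length (W k))))"
    unfolding subword_at_tower_point by (rule sublist_order.order.trans)
  then obtain j where "u = subword_at tower_point j (length u)"
    by (rule sublist_subword_atE)
  then show "u \<in> language tower_shift"
    unfolding language_def using tower_point_in by blast
qed

end

section \<open>Grammars as systems of set equations\<close>

text \<open>
  The words that a sentential form stands for if every nonterminal \<open>A\<close> stands for the words of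
  \<open>I A\<close>. The languages of the nonterminals are the least solution of the resulting system of
  inclusions. Upper bounds on them are obtained by exhibiting a solution, and membership by applying
  productions, without handling derivations.
\<close>

fun expansions :: "(nat \<Rightarrow> nat list set) \<Rightarrow> symbol list \<Rightarrow> nat list set" where
  "expansions I [] = {[]}"
| "expansions I (Tm a # \<alpha>) = {a # w | w. w \<in> expansions I \<alpha>}"
| "expansions I (NT A # \<alpha>) = {u @ w | u w. u \<in> I A \<and> w \<in> expansions I \<alpha>}"

definition nt_language :: "cfg \<Rightarrow> nat \<Rightarrow> nat list set" where
  "nt_language G A = {w. (derive1 G)\<^sup>*\<^sup>* [NT A] (map Tm w)}"

lemma cfg_language_eq: "cfg_language G = nt_language G (start G)"
  by (simp add: cfg_language_def nt_language_def)

lemma expansions_append: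
  "expansions I (\<alpha> @ \<beta>) = {u @ w | u w. u \<in> expansions I \<alpha> \<and> w \<in> expansions I \<beta>}"
proof (induction I \<alpha> rule: expansions.induct)
  case (2 I a \<alpha>)
  then show ?case by (auto, metis append_Cons, blast)
next
  case (3 I A \<alpha>)
  then show ?case by (auto, metis append.assoc, metis append.assoc)
qed simp

lemma nt_language_least:
  assumes "\<And>A r. (A, r) \<in> set (productions G) \<Longrightarrow> expansions I r \<subseteq> I A"
  shows "nt_language G A \<subseteq> I A"
proof
  fix w assume "w \<in> nt_language G A"
  then have "(derive1 G)\<^sup>*\<^sup>* [NT A] (map Tm w)"
    by (simp add: nt_language_def)
  then have "expansions I (map Tm w) \<subseteq> expansions I [NT A]"
  proof (induction rule: rtranclp_induct)
    case (step \<alpha> \<beta>)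
    from step(2) have "expansions I \<beta> \<subseteq> expansions I \<alpha>"
    proof cases
      case (1 B r u v)
      then have "expansions I r \<subseteq> expansions I [NT B]"
        using assms by auto
      then show ?thesis
        unfolding 1 expansions_append by blast
    qed
    with step(3) show ?case by blast
  qed simp
  moreover have "w \<in> expansions I (map Tm w)"
    by (induction w) simp_all
  ultimately show "w \<in> I A"
    by auto
qed

lemma derive1_context: "derive1 G \<alpha> \<beta> \<Longrightarrow> derive1 G (u @ \<alpha> @ v) (u @ \<beta> @ v)"
proof (induction rule: derive1.induct)
  case (1 A r x y)
  then show ?case
    using derive1.intros[of A r G "u @ x" "y @ v"] by simp
qed

lemma derives_context: "(derive1 G)\<^sup>*\<^sup>* \<alpha> \<beta> \<Longrightarrow> (derive1 G)\<^sup>*\<^sup>* (u @ \<alpha> @ v) (u @ \<beta> @ v)"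
  by (induction rule: rtranclp_induct) (auto intro: derive1_context rtranclp.rtrancl_into_rtrancl)

lemma nt_language_closed:
  assumes "(A, r) \<in> set (productions G)" "w \<in> expansions (nt_language G) r"
  shows "w \<in> nt_language G A"
proof -
  have "(derive1 G)\<^sup>*\<^sup>* \<alpha> (map Tm w)" if "w \<in> expansions (nt_language G) \<alpha>" for \<alpha> w
    using that
  proof (induction \<alpha> arbitrary: w)
    case (Cons s \<alpha>)
    show ?case
    proof (cases s)
      case (NT B)
      with Cons.prems obtain u v where w: "w = u @ v" "u \<in> nt_language G B"
        "v \<in> expansions (nt_language G) \<alpha>"
        by auto
      have "(derive1 G)\<^sup>*\<^sup>* (NT B # \<alpha>) (map Tm u @ \<alpha>)"
        using derives_context[of G "[NT B]" "map Tm u" "[]" \<alpha>] w(2) by (simp add: nt_language_def)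
      also have "(derive1 G)\<^sup>*\<^sup>* (map Tm u @ \<alpha>) (map Tm u @ map Tm v)"
        using derives_context[OF Cons.IH[OF w(3)], of "map Tm u" "[]"] by simp
      finally show ?thesis
        using NT w(1) by simp
    next
      case (Tm a)
      with Cons.prems obtain v where v: "w = a # v" "v \<in> expansions (nt_language G) \<alpha>"
        by auto
      have "(derive1 G)\<^sup>*\<^sup>* ([Tm a] @ \<alpha> @ []) ([Tm a] @ map Tm v @ [])"
        using Cons.IH[OF v(2)] by (rule derives_context)
      with Tm v(1) show ?thesis by simp
    qed
  qed simp
  then have "(derive1 G)\<^sup>*\<^sup>* r (map Tm w)"
    using assms(2) .
  moreover have "derive1 G [NT A] r"
    using derive1.intros[OF assms(1), of "[]" "[]"] by simp
  ultimately show ?thesis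
    unfolding nt_language_def by (simp add: converse_rtranclp_into_rtranclp)
qed

section \<open>Counting separators with a pushdown\<close>

definition separators :: "nat \<Rightarrow> nat list" where
  "separators m = 0 # replicate m 1 @ [2]"

text \<open>
  The pushdown automaton behind the grammar: started after an opening bracket, it returns the
  number of separators outside inner brackets when it meets the matching closing bracket, and ignores
  what follows. The stack is the depth \<open>d\<close>.
\<close>

fun scan :: "nat \<Rightarrow> nat \<Rightarrow> nat list \<Rightarrow> nat option" where
  "scan d c [] = None"
| "scan d c (a # v) =
    (if a = 0 then scan (Suc d) c v
     else if a = 1 then scan d (if d = 0 then Suc c else c) v
     else (case d of 0 \<Rightarrow> Some c | Suc e \<Rightarrow> scan e c v))"

text \<open>
  Words that the automaton passes over without any effect when it is at depth \<open>d0\<close> or more. With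
  \<open>d0 = 0\<close> such a word cannot have a separator outside brackets; with \<open>d0 = 1\<close> it can, because separators
  are counted at depth 0 only.
\<close>

definition balanced :: "nat \<Rightarrow> nat list set" where
  "balanced d0 = {u. \<forall>d\<ge>d0. \<forall>c v. scan d c (u @ v) = scan d c v}"

primrec counting_tail :: "nat \<Rightarrow> symbol list" where
  "counting_tail 0 = [Tm 2]"
| "counting_tail (Suc n) = Tm 1 # NT 1 # counting_tail n"

text \<open>
  Nonterminal 1 produces balanced words without outer separators, nonterminal 2 balanced words with
  arbitrary separators. The argument \<open>n\<close> only affects the production for the start symbol 0.
\<close>

definition counting_grammar :: "nat \<Rightarrow> cfg" where
  "counting_grammar n = CFG 0
     [(0, Tm 0 # NT 1 # counting_tail n),
      (1, []), (1, [NT 1, NT 1]), (1, [Tm 0, NT 2, Tm 2]),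
      (2, [NT 1]), (2, [NT 2, Tm 1, NT 2])]"

lemma start_counting_grammar [simp]: "start (counting_grammar n) = 0"
  by (simp add: counting_grammar_def)

lemma cfg_over_counting_grammar: "cfg_over {0, 1, 2} (counting_grammar n)"
proof -
  have "a \<in> {1, 2}" if "Tm a \<in> set (counting_tail n)" for a
    using that by (induction n) auto
  then show ?thesis
    by (auto simp: cfg_over_def counting_grammar_def)
qed

lemma scan_append: "scan d c u = Some n \<Longrightarrow> scan d c (u @ v) = Some n"
  by (induction d c u rule: scan.induct) (auto split: if_splits nat.splits)

lemma counting_grammar_sound:
  "nt_language (counting_grammar n) 0 \<subseteq> {0 # u | u. scan 0 0 u = Some n}"
  "nt_language (counting_grammar n) 1 \<subseteq> balanced 0"
proof -
  define I where "I A = (if A = 0 then {0 # u | u. scan 0 0 u = Some n}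
    else if A = 1 then balanced 0 else if A = 2 then balanced 1 else UNIV)" for A :: nat
  have I: "I 0 = {0 # u | u. scan 0 0 u = Some n}" "I 1 = balanced 0" "I (Suc 0) = balanced 0"
    "I 2 = balanced 1"
    by (simp_all add: I_def)
  have tail: "scan 0 c u = Some (c + m)" if "u \<in> expansions I (NT 1 # counting_tail m)" for c u m
    using that
  proof (induction m arbitrary: c u)
    case 0
    then show ?case by (auto simp: I balanced_def)
  next
    case (Suc m)
    then obtain x y where u: "u = x @ 1 # y" "x \<in> balanced 0" "y \<in> expansions I (NT 1 # counting_tail m)"
      by (auto simp: I)
    with Suc.IH[OF u(3), of "Suc c"] show ?case
      by (simp add: balanced_def)
  qed
  have "expansions I r \<subseteq> I A" if "(A, r) \<in> set (productions (counting_grammar n))" for A r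
  proof -
    from that consider "A = 0" "r = Tm 0 # NT 1 # counting_tail n" | "A = 1" "r = []"
      | "A = 1" "r = [NT 1, NT 1]" | "A = 1" "r = [Tm 0, NT 2, Tm 2]"
      | "A = 2" "r = [NT 1]" | "A = 2" "r = [NT 2, Tm 1, NT 2]"
      by (auto simp: counting_grammar_def)
    then show ?thesis
    proof cases
      case 1
      then show ?thesis
        using tail[of _ n 0] by (auto simp del: expansions.simps(3) simp add: I)
    qed (auto simp: I balanced_def)
  qed
  from nt_language_least[of "counting_grammar n" I, OF this]
  show "nt_language (counting_grammar n) 0 \<subseteq> {0 # u | u. scan 0 0 u = Some n}"
    "nt_language (counting_grammar n) 1 \<subseteq> balanced 0"
    using I by blast+
qed

lemma weave_separators:
  "weave w (separators m) = w @ 0 # weave w (replicate m 1) @ 2 # w"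
  by (simp add: separators_def weave_Cons weave_append[of w "replicate m 1" 2 "[]", simplified])

lemma counting_grammar_block:
  assumes "w \<in> nt_language (counting_grammar n) 1"
  shows "0 # weave w (replicate n 1) @ [2] \<in> nt_language (counting_grammar n) 0"
proof -
  let ?L = "nt_language (counting_grammar n)"
  have "weave w (replicate m 1) @ [2] \<in> expansions ?L (NT 1 # counting_tail m)" for m
  proof (induction m)
    case 0
    with assms show ?case by auto
  next
    case (Suc m)
    then have "1 # weave w (replicate m 1) @ [2] \<in> expansions ?L (counting_tail (Suc m))"
      by simp
    with assms show ?case
      by (simp add: weave_Cons) blast
  qed
  then have "0 # weave w (replicate n 1) @ [2] \<in> expansions ?L (Tm 0 # NT 1 # counting_tail n)"
    by simp
  then show ?thesis
    by (rule nt_language_closed[rotated]) (simp add: counting_grammar_def)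
qed

lemma tower_in_counting_grammar:
  "tower (\<lambda>k. separators (\<mu> k)) k \<in> nt_language (counting_grammar n) 1"
proof (induction k)
  let ?L = "nt_language (counting_grammar n)"
  have closed: "w \<in> ?L 1" if "w \<in> expansions ?L r" "r \<in> {[], [NT 1, NT 1], [Tm 0, NT 2, Tm 2]}" for w r
    using that(1) by (rule nt_language_closed[rotated]) (use that(2) in \<open>auto simp: counting_grammar_def\<close>)
  have concat_closed: "u @ v \<in> ?L 1" if "u \<in> ?L 1" "v \<in> ?L 1" for u v
    by (rule closed[of _ "[NT 1, NT 1]"]) (use that in auto)
  have closed2: "w \<in> ?L 2" if "w \<in> expansions ?L r" "r \<in> {[NT 1], [NT 2, Tm 1, NT 2]}" for w r
    using that(1) by (rule nt_language_closed[rotated]) (use that(2) in \<open>auto simp: counting_grammar_def\<close>)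
  {
    case 0
    show ?case
      using closed[of _ "[]"] by simp
  next
    case (Suc k)
    let ?w = "tower (\<lambda>k. separators (\<mu> k)) k"
    have inner: "weave ?w (replicate m 1) \<in> ?L 2" for m
    proof (induction m)
      case 0
      show ?case
        using closed2[of _ "[NT 1]"] Suc by simp
    next
      case (Suc m)
      have "?w \<in> ?L 2"
        using closed2[of _ "[NT 1]"] \<open>?w \<in> ?L 1\<close> by simp
      with Suc have "?w @ 1 # weave ?w (replicate m 1) \<in> expansions ?L [NT 2, Tm 1, NT 2]"
        by auto
      then have "?w @ 1 # weave ?w (replicate m 1) \<in> ?L 2"
        by (rule closed2) simp
      then show ?case
        by (simp add: weave_Cons)
    qed
    have "0 # weave ?w (replicate (\<mu> k) 1) @ [2] \<in> ?L 1"
      using closed[of _ "[Tm 0, NT 2, Tm 2]"] inner by auto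
    then have "?w @ (0 # weave ?w (replicate (\<mu> k) 1) @ [2]) @ ?w \<in> ?L 1"
      by (intro concat_closed Suc)
    then show ?case
      by (simp add: weave_separators)
  }
qed

lemma scan_weave:
  assumes "w \<in> balanced 0"
  shows "scan 0 c (weave w (replicate m 1) @ 2 # v) = Some (c + m)"
  using assms by (induction m arbitrary: c) (simp_all add: balanced_def weave_Cons)

definition matched :: "(nat \<Rightarrow> nat) \<Rightarrow> nat list \<Rightarrow> bool" where
  "matched \<mu> w \<longleftrightarrow> (\<forall>p v. w = p @ 0 # v \<longrightarrow> (\<exists>k. \<forall>z. scan 0 0 (v @ z) = Some (\<mu> k)))"

lemma matched_append:
  assumes "matched \<mu> u" "matched \<mu> w"
  shows "matched \<mu> (u @ w)"
  unfolding matched_def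
proof (intro allI impI)
  fix p v assume "u @ w = p @ 0 # v"
  then consider q where "u = p @ 0 # q" "v = q @ w" | q where "w = q @ 0 # v"
    by (auto simp: append_eq_append_conv2 append_eq_Cons_conv)
  then show "\<exists>k. \<forall>z. scan 0 0 (v @ z) = Some (\<mu> k)"
  proof cases
    case 1
    then obtain k where "\<forall>z. scan 0 0 (q @ z) = Some (\<mu> k)"
      using assms(1) unfolding matched_def by blast
    with 1 show ?thesis by auto
  next
    case 2
    then show ?thesis
      using assms(2) unfolding matched_def by blast
  qed
qed

text \<open>
  Every opening bracket of a tower is matched, and its partner closes the same level \<open>k\<close>, because
  the copies of the lower levels between them are balanced. In \<^const>\<open>matched\<close> the arbitrary continuation
  \<open>z\<close> is what makes the property stable under concatenation.
\<close>

lemma matched_tower: "matched \<mu> (tower (\<lambda>k. separators (\<mu> k)) k)"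
proof (induction k)
  case 0
  show ?case by (simp add: matched_def)
next
  case (Suc k)
  let ?w = "tower (\<lambda>k. separators (\<mu> k)) k"
  have letter: "matched \<mu> [s]" if "s \<noteq> 0" for s
    using that by (auto simp: matched_def Cons_eq_append_conv)
  have "matched \<mu> (weave ?w ss)" if "0 \<notin> set ss" for ss
    using that
  proof (induction ss)
    case Nil
    show ?case using Suc by simp
  next
    case (Cons s ss)
    then have "matched \<mu> (?w @ [s] @ weave ?w ss)"
      by (intro matched_append Suc letter) auto
    then show ?case by (simp add: weave_Cons)
  qed
  then have "matched \<mu> (weave ?w (replicate (\<mu> k) 1) @ [2] @ ?w)"
    by (intro matched_append Suc letter) auto
  moreover have "?w \<in> balanced 0"
    using tower_in_counting_grammar counting_grammar_sound(2) by blast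
  then have "scan 0 0 ((weave ?w (replicate (\<mu> k) 1) @ [2] @ ?w) @ z) = Some (\<mu> k)" for z
    using scan_weave[of ?w 0] by simp
  ultimately have "matched \<mu> (0 # weave ?w (replicate (\<mu> k) 1) @ [2] @ ?w)"
    unfolding matched_def by (auto simp: Cons_eq_append_conv simp del: append_assoc)
  then have "matched \<mu> (?w @ 0 # weave ?w (replicate (\<mu> k) 1) @ [2] @ ?w)"
    by (rule matched_append[OF Suc])
  then show ?case
    by (simp add: weave_separators)
qed

text \<open>
  A word of the grammar inside a tower starts with an opening bracket of some level \<open>k\<close>, and the
  automaton returns both \<open>n\<close> and \<open>\<mu> k\<close> on what follows.
\<close>

lemma counting_grammar_meets_tower_iff:
  "(\<exists>u k. sublist u (tower (\<lambda>k. separators (\<mu> k)) k) \<and> u \<in> cfg_language (counting_grammar n))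
    \<longleftrightarrow> n \<in> range \<mu>"
proof
  let ?W = "tower (\<lambda>k. separators (\<mu> k))"
  assume "\<exists>u k. sublist u (?W k) \<and> u \<in> cfg_language (counting_grammar n)"
  then obtain u k where u: "sublist u (?W k)" "u \<in> nt_language (counting_grammar n) 0"
    by (auto simp: cfg_language_eq)
  then obtain v where v: "u = 0 # v" "scan 0 0 v = Some n"
    using counting_grammar_sound(1) by blast
  with u(1) obtain p q where "?W k = p @ 0 # (v @ q)"
    by (auto simp: sublist_def)
  then obtain j where "scan 0 0 ((v @ q) @ []) = Some (\<mu> j)"
    using matched_tower[of \<mu> k] unfolding matched_def by blast
  with scan_append[OF v(2), of q] show "n \<in> range \<mu>"
    by simp
next
  let ?W = "tower (\<lambda>k. separators (\<mu> k))"
  assume "n \<in> range \<mu>"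
  then obtain k where k: "n = \<mu> k" by blast
  let ?u = "0 # weave (?W k) (replicate n 1) @ [2]"
  have "?W (Suc k) = ?W k @ ?u @ ?W k"
    by (simp add: weave_separators k)
  then have "sublist ?u (?W (Suc k))"
    unfolding sublist_def by blast
  moreover have "?u \<in> cfg_language (counting_grammar n)"
    unfolding cfg_language_eq start_counting_grammar
    by (intro counting_grammar_block tower_in_counting_grammar)
  ultimately show "\<exists>u k. sublist u (?W k) \<and> u \<in> cfg_language (counting_grammar n)"
    by blast
qed

section \<open>The subshift of halting computations\<close>

text \<open>
  The sequence runs through all pairs of a computation \<open>e\<close> and a candidate for a certificate that it
  halts. The value 1 is the default for failed candidates, for no level may be without separators;
  hence the offset 2 for successful ones.
\<close>

definition marks :: "nat \<Rightarrow> nat" where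
  "marks k = (case decode k :: (recf \<times> nat) \<times> (recf \<times> nat list \<times> nat) list of
     (e, C) \<Rightarrow> if halting_certificate e C then Suc (Suc (encode e)) else 1)"

lemma in_range_marks_iff:
  "Suc (Suc (encode (p, n))) \<in> range marks \<longleftrightarrow> recf_eval p [n] \<noteq> None"
proof -
  have "Suc (Suc (encode (p, n))) \<in> range marks \<longleftrightarrow> (\<exists>C. halting_certificate (p, n) C)"
  proof
    assume "Suc (Suc (encode (p, n))) \<in> range marks"
    then obtain k where "marks k = Suc (Suc (encode (p, n)))"
      by auto
    then show "\<exists>C. halting_certificate (p, n) C"
      unfolding marks_def by (auto simp del: encode_Pair split: prod.splits if_splits)
  next
    assume "\<exists>C. halting_certificate (p, n) C"
    then obtain C where "halting_certificate (p, n) C" by blast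
    then have "marks (encode ((p, n), C)) = Suc (Suc (encode (p, n)))"
      unfolding marks_def decode_encode by simp
    then show "Suc (Suc (encode (p, n))) \<in> range marks"
      by (metis rangeI)
  qed
  then show ?thesis
    by (simp only: halting_certificate_iff)
qed

lemma effective_marks: "effective marks"
  unfolding marks_def by (intro effective_intro)

lemma effective_tower:
  assumes "effective b" "effective n"
  shows "effective (\<lambda>x. tower b (n x))"
proof -
  have "tower b k = rec_nat [] (\<lambda>k w. weave w (b k)) k" for k
    by (induction k) simp_all
  then have *: "tower b = rec_nat [] (\<lambda>k w. weave w (b k))"
    by (simp add: fun_eq_iff)
  show ?thesis
    unfolding * weave_def by (intro effective_intro assms effective_comp[OF assms(1)])
qed

lemma effective_counting_grammar: "effective counting_grammar"
proof -
  have "counting_tail n = rec_nat [Tm 2] (\<lambda>n r. Tm 1 # NT 1 # r) n" for n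
    by (induction n) simp_all
  then have *: "counting_tail = rec_nat [Tm 2] (\<lambda>n r. Tm 1 # NT 1 # r)"
    by (simp add: fun_eq_iff)
  show ?thesis
    unfolding counting_grammar_def * by (intro effective_intro)
qed

text \<open>
  As \<^const>\<open>marks\<close> is computable, the language of the subshift is decidable, and so the complement of
  the language and the model-checking problem are recursively enumerable. For hardness,
  a program \<open>p\<close> and an input \<open>n\<close> are mapped to the grammar that looks for the mark of \<open>(p, n)\<close>.
\<close>

theorem theorem6:
  "\<exists>(S :: nat set) (X :: (int \<Rightarrow> nat) set).
     finite S \<and> minimal_subshift S X \<and> pi01_subshift S X \<and>
     sigma01_complete (cfg_model_checking S X)"
proof -
  let ?b = "\<lambda>k. separators (marks k)"
  let ?S = "set [0, 1, 2 :: nat]"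
  have marks: "marks k \<noteq> 0" for k
    by (simp add: marks_def split: prod.split)
  interpret separator_sequence ?b ?S
    by standard (auto simp: separators_def set_replicate_conv_if marks)
  have b: "effective ?b"
    unfolding separators_def by (intro effective_intro effective_comp[OF effective_marks])
  have language: "u \<in> language tower_shift \<longleftrightarrow> sublist u (tower ?b (Suc (length u)))" for u
    using language_tower_shift sublist_tower_iff by blast
  have decidable: "effective (\<lambda>u. u \<in> language tower_shift)"
    unfolding language by (intro effective_intro effective_tower[OF b])
  have pi01: "pi01_subshift ?S tower_shift"
    unfolding pi01_subshift_def
  proof
    let ?Q = "\<lambda>u (y :: nat). (\<forall>a\<in>set u. a \<in> ?S) \<and> u \<notin> language tower_shift"
    have "effective (\<lambda>p. ?Q (fst p) (snd p))"
      by (intro effective_intro effective_comp[OF decidable])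
    then have "recursively_enumerable {encode u | u. \<exists>y. ?Q u y}"
      by (rule recursively_enumerable_projection)
    moreover have "encode u = list_encode u" for u :: "nat list"
      by (simp add: encode_list_def map_idI)
    then have "{encode u | u. \<exists>y. ?Q u y} = list_encode ` (lists ?S - language tower_shift)"
      by (auto simp: image_def)
    ultimately show "recursively_enumerable (list_encode ` (lists ?S - language tower_shift))"
      by simp
  qed (rule subshift_tower_shift)
  have meets: "language tower_shift \<inter> cfg_language (counting_grammar n) \<noteq> {} \<longleftrightarrow> n \<in> range marks" for n
    using counting_grammar_meets_tower_iff[of marks n] language_tower_shift by blast
  have complete: "sigma01_complete (cfg_model_checking ?S tower_shift)"
    unfolding sigma01_complete_def
  proof (intro conjI allI impI)
    have "cfg_model_checking ?S tower_shift =
        {cfg_encode G | G. cfg_over ?S G \<and> (\<exists>w\<in>cfg_language G. w \<in> language tower_shift)}"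
      unfolding cfg_model_checking_def by blast
    then show "recursively_enumerable (cfg_model_checking ?S tower_shift)"
      using recursively_enumerable_cfg_meets[OF decidable, of "[0, 1, 2]"] by simp
  next
    fix B assume "recursively_enumerable B"
    then obtain p where p: "B = {n. recf_eval p [n] \<noteq> None}"
      unfolding recursively_enumerable_def by blast
    let ?G = "\<lambda>n :: nat. counting_grammar (Suc (Suc (encode (p, n))))"
    have "effective (\<lambda>n. encode (?G n))"
      by (intro effective_intro effective_comp[OF effective_counting_grammar])
    then have "computable (\<lambda>n. cfg_encode (?G n))"
      unfolding effective_nat_iff cfg_encode_eq_encode .
    moreover have "n \<in> B \<longleftrightarrow> cfg_encode (?G n) \<in> cfg_model_checking ?S tower_shift" for n
    proof -
      have "cfg_encode (?G n) \<in> cfg_model_checking ?S tower_shift \<longleftrightarrow>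
          language tower_shift \<inter> cfg_language (?G n) \<noteq> {}"
        using cfg_over_counting_grammar unfolding cfg_model_checking_def cfg_encode_eq_encode by auto
      then show ?thesis
        unfolding meets in_range_marks_iff p by simp
    qed
    ultimately show "B \<le>\<^sub>m cfg_model_checking ?S tower_shift"
      unfolding many_one_reducible_def by blast
  qed
  show ?thesis
    using finite_S minimal_tower_shift pi01 complete by blast
qed

end
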